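(* Let $\rho_0\in\mathcal P_2^{ac}(\mathbb R^d)$ and $\lambda\in\mathbb R$. Let $D:\mathcal P_2(\mathbb R^d)\to\mathbb R$ be lower semicontinuous with respect to the weak topology on $\mathcal P_2(\mathbb R^d)$, Wasserstein differentiable, and $\lambda$-convex along generalized geodesics with anchor point $\rho_0$, and suppose that $D$ has a unique minimizer $\gamma$. Let $\tau>0$ and let $(\widehat T_k^\tau)_{k\ge0}$ be a solution of the proximal scheme $$\widehat T_0^\tau=\mathrm{id},\qquad \widehat T_{k+1}^\tau\in\operatorname*{arg\,min}_{T\in K_{\rho_0}}\ D(T_*\rho_0)+\frac1{2\tau}\|T-\widehat T_k^\tau\|^2_{L^2_{\rho_0}}\quad(k\ge0).$$ Then: (i) if $\lambda=0$, then $\widehat T_k^\tau\rightharpoonup T_{\rho_0}^\gamma$ weakly in $L^2_{\rho_0}(\mathbb R^d,\mathbb R^d)$ as $k\to\infty$; (ii) if $\lambda>0$, then $\widehat T_k^\tau\to T_{\rho_0}^\gamma$ strongly in $L^2_{\rho_0}(\mathbb R^d,\mathbb R^d)$ as $k\to\infty$, with convergence rate $O(\alpha^k)$ where $\alpha=(1+\lambda^2\tau^2/4)^{-1/2}<1$.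
   Context: $\mathcal P_2(\mathbb R^d)$ is the set of Borel probability measures on $\mathbb R^d$ ($d\ge1$) with finite second moment, with the $2$-Wasserstein distance $W_2$; the "weak topology" on it is the one metrized by $W_2$ (narrow convergence plus convergence of second moments), written $\rightharpoonup$. $\mathcal P_2^{ac}(\mathbb R^d)$ is the subset of measures absolutely continuous w.r.t. Lebesgue measure. $T_*\rho$ is the pushforward. $L^2_{\rho}(\mathbb R^d,\mathbb R^d)$ is the Hilbert space of $\rho$-square-integrable maps. $K_{\rho_0}\subset L^2_{\rho_0}(\mathbb R^d,\mathbb R^d)$ is the set of all $\nabla\phi\in L^2_{\rho_0}(\mathbb R^d,\mathbb R^d)$ with $\phi$ convex; convex functions may be $+\infty$ off a set of full $\rho_0$-measure, so that by Brenier's theorem $K_{\rho_0}$ is exactly the set of optimal transport maps (quadratic cost) from $\rho_0$ to elements of $\mathcal P_2(\mathbb R^d)$. $T_{\rho_0}^{\rho}\in K_{\rho_0}$ is the optimal transport map from $\rho_0$ to $\rho$. Wasserstein differentiability: let $\Pi_o(\rho,\gamma)$ be the set of optimal plans between $\rho$ and $\gamma$. $\partial^-D(\rho)$ is the set of $\xi\in L^2_\rho(\mathbb R^d,\mathbb R^d)$ with $D(\gamma)-D(\rho)\ge\inf_{\pi\in\Pi_o(\rho,\gamma)}\iint\langle\xi(x),y-x\rangle\,d\pi(x,y)+o(W_2(\rho,\gamma))$ as $\gamma\rightharpoonup\rho$; $\partial^+D(\rho)=-\partial^-(-D)(\rho)$. $D$ is Wasserstein differentiable if $\partial^-D(\rho)\cap\partial^+D(\rho)\neq\emptyset$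 for every $\rho$. $D$ is $\lambda$-convex along generalized geodesics with anchor point $\rho_0$ if for all $\rho_1,\rho_2\in\mathcal P_2(\mathbb R^d)$ and $t\in[0,1]$, with $\rho_t=[(1-t)T_{\rho_0}^{\rho_1}+tT_{\rho_0}^{\rho_2}]_*\rho_0$, $$D(\rho_t)\le(1-t)D(\rho_1)+tD(\rho_2)-\tfrac\lambda2t(1-t)\|T_{\rho_0}^{\rho_1}-T_{\rho_0}^{\rho_2}\|^2_{L^2_{\rho_0}}.$$ *)

theory Defs
  imports "HOL-Probability.Probability" "HOL-Library.Landau_Symbols"
begin

definition P2 :: "'a::euclidean_space measure set" where
  "P2 = {\<mu>. prob_space \<mu> \<and> sets \<mu> = sets borel \<and> integrable \<mu> (\<lambda>x. (norm x)\<^sup>2)}"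

definition P2ac :: "'a::euclidean_space measure set" where
  "P2ac = {\<mu> \<in> P2. absolutely_continuous lborel \<mu>}"


text \<open>Elements of $L^2$ are represented by measurable functions, without passing to the quotient;
  the notions below are invariant under measurable modification on null sets (the initial map of
  the proximal scheme is fixed to be the representative \<open>id\<close>).\<close>

definition L2 :: "'a::euclidean_space measure \<Rightarrow> ('a \<Rightarrow> 'a) set" where
  "L2 \<mu> = {\<xi> \<in> borel_measurable \<mu>. integrable \<mu> (\<lambda>x. (norm (\<xi> x))\<^sup>2)}"

definition L2norm :: "'a::euclidean_space measure \<Rightarrow> ('a \<Rightarrow> 'a) \<Rightarrow> real" where
  "L2norm \<mu> \<xi> = sqrt (\<integral>x. (norm (\<xi> x))\<^sup>2 \<partial>\<mu>)"

definition L2_tendsto :: "'a::euclidean_space measure \<Rightarrow> (nat \<Rightarrow> 'a \<Rightarrow> 'a) \<Rightarrow> ('a \<Rightarrow> 'a) \<Rightarrow> bool" where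
  "L2_tendsto \<mu> T S \<longleftrightarrow> (\<lambda>k. L2norm \<mu> (\<lambda>x. T k x - S x)) \<longlonglongrightarrow> 0"

definition L2_weakly_tendsto :: "'a::euclidean_space measure \<Rightarrow> (nat \<Rightarrow> 'a \<Rightarrow> 'a) \<Rightarrow> ('a \<Rightarrow> 'a) \<Rightarrow> bool" where
  "L2_weakly_tendsto \<mu> T S \<longleftrightarrow>
    (\<forall>\<xi>\<in>L2 \<mu>. (\<lambda>k. \<integral>x. T k x \<bullet> \<xi> x \<partial>\<mu>) \<longlonglongrightarrow> (\<integral>x. S x \<bullet> \<xi> x \<partial>\<mu>))"


definition couplings :: "'a::euclidean_space measure \<Rightarrow> 'a measure \<Rightarrow> ('a \<times> 'a) measure set" where
  "couplings \<mu> \<nu> = {\<pi>. sets \<pi> = sets borel \<and> distr \<pi> borel fst = \<mu> \<and> distr \<pi> borel snd = \<nu>}"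

text \<open>The Bochner integral, used for the cost, is only meaningful for couplings of measures
  in \<^const>\<open>P2\<close>, where the integrand is always integrable.\<close>

definition transport_cost :: "('a::euclidean_space \<times> 'a) measure \<Rightarrow> real" where
  "transport_cost \<pi> = (\<integral>z. (norm (snd z - fst z))\<^sup>2 \<partial>\<pi>)"

definition W2 :: "'a::euclidean_space measure \<Rightarrow> 'a measure \<Rightarrow> real" where
  "W2 \<mu> \<nu> = sqrt (INF \<pi>\<in>couplings \<mu> \<nu>. transport_cost \<pi>)"

definition optimal_plans :: "'a::euclidean_space measure \<Rightarrow> 'a measure \<Rightarrow> ('a \<times> 'a) measure set" where
  "optimal_plans \<mu> \<nu> = {\<pi>. is_arg_min transport_cost (\<lambda>\<pi>. \<pi> \<in> couplings \<mu> \<nu>) \<pi>}"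


text \<open>A convex function with values in $(-\infty,+\infty]$ is given by its effective domain \<open>S\<close> and
  its real values there. The condition \<open>x \<in> interior S\<close> ensures that differentiability at \<open>x\<close> does
  not depend on the irrelevant values of \<open>\<phi>\<close> outside of \<open>S\<close>.\<close>

definition convex_gradients :: "'a::euclidean_space measure \<Rightarrow> ('a \<Rightarrow> 'a) set" where
  "convex_gradients \<mu> = {T \<in> L2 \<mu>. \<exists>S \<phi>. convex_on S \<phi> \<and>
      (AE x in \<mu>. x \<in> interior S \<and> GDERIV \<phi> x :> T x)}"

text \<open>For an absolutely continuous \<open>\<mu> \<in> P2\<close> and any \<open>\<nu> \<in> P2\<close>, such a \<open>T\<close> exists and is unique up to
  null sets by Brenier's theorem. Since it is only determined up to null sets, it is described by
  a predicate.\<close>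

definition is_optimal_map :: "'a::euclidean_space measure \<Rightarrow> 'a measure \<Rightarrow> ('a \<Rightarrow> 'a) \<Rightarrow> bool" where
  "is_optimal_map \<mu> \<nu> T \<longleftrightarrow> T \<in> convex_gradients \<mu> \<and> distr \<mu> borel T = \<nu> \<and>
    distr \<mu> borel (\<lambda>x. (x, T x)) \<in> optimal_plans \<mu> \<nu>"


text \<open>Functionals on \<^const>\<open>P2\<close> are functions on all measures whose values outside of \<^const>\<open>P2\<close>
  are never used.\<close>

definition W2_lower_semicontinuous :: "('a::euclidean_space measure \<Rightarrow> real) \<Rightarrow> bool" where
  "W2_lower_semicontinuous D \<longleftrightarrow>
    (\<forall>\<rho>\<in>P2. \<forall>\<epsilon>>0. \<exists>\<delta>>0. \<forall>\<gamma>\<in>P2. W2 \<rho> \<gamma> < \<delta> \<longrightarrow> D \<gamma> > D \<rho> - \<epsilon>)"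

definition wasserstein_subdiff ::
    "('a::euclidean_space measure \<Rightarrow> real) \<Rightarrow> 'a measure \<Rightarrow> ('a \<Rightarrow> 'a) set" where
  "wasserstein_subdiff D \<rho> = {\<xi> \<in> L2 \<rho>. \<forall>\<epsilon>>0. \<exists>\<delta>>0. \<forall>\<gamma>\<in>P2. W2 \<rho> \<gamma> < \<delta> \<longrightarrow>
      D \<gamma> - D \<rho> \<ge> (INF \<pi>\<in>optimal_plans \<rho> \<gamma>. \<integral>z. \<xi> (fst z) \<bullet> (snd z - fst z) \<partial>\<pi>) - \<epsilon> * W2 \<rho> \<gamma>}"

definition wasserstein_superdiff ::
    "('a::euclidean_space measure \<Rightarrow> real) \<Rightarrow> 'a measure \<Rightarrow> ('a \<Rightarrow> 'a) set" where
  "wasserstein_superdiff D \<rho> = {\<xi>. (\<lambda>x. - \<xi> x) \<in> wasserstein_subdiff (\<lambda>\<mu>. - D \<mu>) \<rho>}"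

definition wasserstein_differentiable :: "('a::euclidean_space measure \<Rightarrow> real) \<Rightarrow> bool" where
  "wasserstein_differentiable D \<longleftrightarrow>
    (\<forall>\<rho>\<in>P2. wasserstein_subdiff D \<rho> \<inter> wasserstein_superdiff D \<rho> \<noteq> {})"

definition convex_along_gen_geodesics ::
    "real \<Rightarrow> 'a::euclidean_space measure \<Rightarrow> ('a measure \<Rightarrow> real) \<Rightarrow> bool" where
  "convex_along_gen_geodesics lam \<rho>\<^sub>0 D \<longleftrightarrow>
    (\<forall>\<rho>\<^sub>1\<in>P2. \<forall>\<rho>\<^sub>2\<in>P2. \<forall>T\<^sub>1 T\<^sub>2. \<forall>t\<in>{0..1}.
      is_optimal_map \<rho>\<^sub>0 \<rho>\<^sub>1 T\<^sub>1 \<longrightarrow> is_optimal_map \<rho>\<^sub>0 \<rho>\<^sub>2 T\<^sub>2 \<longrightarrow>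
      D (distr \<rho>\<^sub>0 borel (\<lambda>x. (1 - t) *\<^sub>R T\<^sub>1 x + t *\<^sub>R T\<^sub>2 x))
        \<le> (1 - t) * D \<rho>\<^sub>1 + t * D \<rho>\<^sub>2
           - lam / 2 * t * (1 - t) * (L2norm \<rho>\<^sub>0 (\<lambda>x. T\<^sub>1 x - T\<^sub>2 x))\<^sup>2)"

definition is_unique_minimizer :: "('a::euclidean_space measure \<Rightarrow> real) \<Rightarrow> 'a measure \<Rightarrow> bool" where
  "is_unique_minimizer D \<gamma> \<longleftrightarrow> is_arg_min D (\<lambda>\<rho>. \<rho> \<in> P2) \<gamma> \<and>
    (\<forall>\<rho>. is_arg_min D (\<lambda>\<rho>. \<rho> \<in> P2) \<rho> \<longrightarrow> \<rho> = \<gamma>)"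

definition proximal_scheme ::
    "('a::euclidean_space measure \<Rightarrow> real) \<Rightarrow> 'a measure \<Rightarrow> real \<Rightarrow> (nat \<Rightarrow> 'a \<Rightarrow> 'a) \<Rightarrow> bool" where
  "proximal_scheme D \<rho>\<^sub>0 \<tau> T \<longleftrightarrow> T 0 = id \<and>
    (\<forall>k. is_arg_min (\<lambda>S. D (distr \<rho>\<^sub>0 borel S) + 1 / (2 * \<tau>) * (L2norm \<rho>\<^sub>0 (\<lambda>x. S x - T k x))\<^sup>2)
                    (\<lambda>S. S \<in> convex_gradients \<rho>\<^sub>0) (T (Suc k)))"

end

theory Submission
  imports Defs
begin

text \<open>Write $F(S) = D(S_*\rho_0)$ for $S$ in the convex set $K_{\rho_0}$. Every element of
  $K_{\rho_0}$ is an optimal map, so $F$ is $\lambda$-convex on $K_{\rho_0}$. Comparing the proximal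
  step with the segment towards $T_\gamma = T_{\rho_0}^\gamma$ gives
  \[F(T_{k+1}) + \tfrac1{2\tau}\|T_{k+1}-T_k\|^2
    + \tfrac{\lambda+1/\tau}2\|T_{k+1}-T_\gamma\|^2
    \le F(T_\gamma) + \tfrac1{2\tau}\|T_k-T_\gamma\|^2.\]
  For $\lambda > 0$ this and $F(T_{k+1}) \ge F(T_\gamma) + \frac\lambda2\|T_{k+1}-T_\gamma\|^2$
  make the step a contraction with factor $1/(1+\lambda\tau) \le \alpha$. For $\lambda = 0$ the scheme
  is a bounded minimizing sequence. If it stayed on one side of a hyperplane strictly separated from
  $T_\gamma$ infinitely often, then elements of almost minimal norm in the convex sets of almost
  minimizers beyond that hyperplane would converge strongly to some $z$. By lower semicontinuity
  and uniqueness of the minimizer both $z$ and $(z+T_\gamma)/2$ push $\rho_0$ to $\gamma$, and strict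
  convexity of the norm gives $z = T_\gamma$, a contradiction.\<close>

section \<open>Hilbert space calculus of square-integrable maps\<close>

lemma P2_D:
  assumes "\<mu> \<in> P2"
  shows P2_prob: "prob_space \<mu>" and P2_sets: "sets \<mu> = sets borel"
    and P2_integrable: "integrable \<mu> (\<lambda>x. (norm x)\<^sup>2)"
  using assms by (auto simp: P2_def)

lemma L2_D:
  assumes "f \<in> L2 \<mu>"
  shows L2_measurable: "f \<in> borel_measurable \<mu>"
    and L2_integrable: "integrable \<mu> (\<lambda>x. (norm (f x))\<^sup>2)"
  using assms by (auto simp: L2_def)

lemma L2norm_power2: "(L2norm \<mu> f)\<^sup>2 = (\<integral>x. (norm (f x))\<^sup>2 \<partial>\<mu>)"
  by (simp add: L2norm_def)

lemma L2norm_nonneg: "0 \<le> L2norm \<mu> f"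
  by (simp add: L2norm_def)

lemma abs_inner_le_mean_square: "\<bar>x \<bullet> y\<bar> \<le> ((norm x)\<^sup>2 + (norm y)\<^sup>2) / 2"
  using Cauchy_Schwarz_ineq2[of x y] sum_squares_bound[of "norm x" "norm y"] by simp

lemma integrable_inner_square:
  fixes f g :: "'b \<Rightarrow> 'a::euclidean_space"
  assumes [measurable]: "f \<in> borel_measurable M" "g \<in> borel_measurable M"
    and "integrable M (\<lambda>x. (norm (f x))\<^sup>2)" "integrable M (\<lambda>x. (norm (g x))\<^sup>2)"
  shows "integrable M (\<lambda>x. f x \<bullet> g x)"
proof (rule Bochner_Integration.integrable_bound)
  show "integrable M (\<lambda>x. ((norm (f x))\<^sup>2 + (norm (g x))\<^sup>2) / 2)"
    using assms by simp
  show "AE x in M. norm (f x \<bullet> g x) \<le> norm (((norm (f x))\<^sup>2 + (norm (g x))\<^sup>2) / 2)"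
    using abs_inner_le_mean_square by (auto intro!: AE_I2)
qed simp

lemma L2_inner_integrable:
  assumes "f \<in> L2 \<mu>" "g \<in> L2 \<mu>"
  shows "integrable \<mu> (\<lambda>x. f x \<bullet> g x)"
  using assms by (intro integrable_inner_square) (auto simp: L2_def)

lemma norm_lincomb_power2:
  fixes x y :: "'a::real_inner"
  shows "(norm (a *\<^sub>R x + b *\<^sub>R y))\<^sup>2 = a\<^sup>2 * (norm x)\<^sup>2 + 2 * a * b * (x \<bullet> y) + b\<^sup>2 * (norm y)\<^sup>2"
  unfolding power2_norm_eq_inner
  by (simp add: inner_add inner_commute[of y x] power2_eq_square algebra_simps)

lemma L2_lincomb:
  assumes "f \<in> L2 \<mu>" "g \<in> L2 \<mu>"
  shows "(\<lambda>x. a *\<^sub>R f x + b *\<^sub>R g x) \<in> L2 \<mu>"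
proof -
  have [measurable]: "f \<in> borel_measurable \<mu>" "g \<in> borel_measurable \<mu>"
    using assms by (auto simp: L2_D)
  have "integrable \<mu> (\<lambda>x. (norm (a *\<^sub>R f x + b *\<^sub>R g x))\<^sup>2)"
    unfolding norm_lincomb_power2
    by (intro Bochner_Integration.integrable_add integrable_mult_right L2_integrable
        L2_inner_integrable assms)
  then show ?thesis by (simp add: L2_def)
qed

lemma L2_diff:
  assumes "f \<in> L2 \<mu>" "g \<in> L2 \<mu>"
  shows "(\<lambda>x. f x - g x) \<in> L2 \<mu>"
  using L2_lincomb[OF assms, of 1 "-1"] by simp

lemma L2_ident:
  assumes "\<mu> \<in> P2"
  shows "(\<lambda>x. x) \<in> L2 \<mu>"
proof -
  have [measurable_cong]: "sets \<mu> = sets borel" using assms by (rule P2_sets)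
  show ?thesis using P2_integrable[OF assms] by (simp add: L2_def)
qed

lemma L2norm_lincomb_power2:
  assumes "f \<in> L2 \<mu>" "g \<in> L2 \<mu>"
  shows "(L2norm \<mu> (\<lambda>x. a *\<^sub>R f x + b *\<^sub>R g x))\<^sup>2
    = a\<^sup>2 * (L2norm \<mu> f)\<^sup>2 + 2 * a * b * (\<integral>x. f x \<bullet> g x \<partial>\<mu>) + b\<^sup>2 * (L2norm \<mu> g)\<^sup>2"
  using assms[THEN L2_integrable] L2_inner_integrable[OF assms]
  unfolding L2norm_power2 norm_lincomb_power2 by simp

lemma L2norm_diff_power2:
  assumes "f \<in> L2 \<mu>" "g \<in> L2 \<mu>"
  shows "(L2norm \<mu> (\<lambda>x. f x - g x))\<^sup>2
    = (L2norm \<mu> f)\<^sup>2 - 2 * (\<integral>x. f x \<bullet> g x \<partial>\<mu>) + (L2norm \<mu> g)\<^sup>2"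
  using L2norm_lincomb_power2[OF assms, of 1 "-1"] by simp

text \<open>The squared norm of \<open>a f + b g\<close> is a nonnegative quadratic form in
  \<open>a\<close> and \<open>b\<close>, so its discriminant has a sign.\<close>

lemma L2_Cauchy_Schwarz:
  assumes "f \<in> L2 \<mu>" "g \<in> L2 \<mu>"
  shows "\<bar>\<integral>x. f x \<bullet> g x \<partial>\<mu>\<bar> \<le> L2norm \<mu> f * L2norm \<mu> g"
proof -
  define A B c where "A = L2norm \<mu> f" "B = L2norm \<mu> g" "c = (\<integral>x. f x \<bullet> g x \<partial>\<mu>)"
  have pos: "0 \<le> A\<^sup>2 * a\<^sup>2 + 2 * a * b * c + b\<^sup>2 * B\<^sup>2" for a b
    using L2norm_lincomb_power2[OF assms, of a b] zero_le_power2
    unfolding A_B_c_def by (metis mult.commute)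
  have AB: "0 \<le> A" "0 \<le> B" by (auto simp: A_B_c_def L2norm_nonneg)
  have "c\<^sup>2 \<le> A\<^sup>2 * B\<^sup>2"
  proof (cases "A = 0")
    case True
    \<comment> \<open>The form is now affine in \<open>a\<close>; if \<open>c \<noteq> 0\<close>,
      the value of \<open>a\<close> chosen below makes it equal to -1.\<close>
    have "0 \<le> 2 * a * c + B\<^sup>2" for a using pos[of a 1] True by simp
    from this[of "- (B\<^sup>2 + 1) / (2 * c)"] show ?thesis
      by (cases "c = 0") (auto simp: field_simps)
  next
    case False
    \<comment> \<open>For \<open>b = A\<^sup>2\<close> the form is minimal in \<open>a\<close> at
      \<open>a = -c\<close>.\<close>
    have "0 \<le> A\<^sup>2 * (A\<^sup>2 * B\<^sup>2 - c\<^sup>2)"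
      using pos[of "-c" "A\<^sup>2"] by (simp add: power2_eq_square algebra_simps)
    with False AB show ?thesis by (simp add: zero_le_mult_iff)
  qed
  then have "c\<^sup>2 \<le> (A * B)\<^sup>2" by (simp add: power_mult_distrib)
  then have "\<bar>c\<bar> \<le> A * B" using AB by (metis abs_le_square_iff abs_of_nonneg mult_nonneg_nonneg)
  then show ?thesis by (simp add: A_B_c_def)
qed

text \<open>Riesz-Fischer. On a probability space an L2 Cauchy sequence is L1 Cauchy, hence has an
  almost everywhere convergent subsequence, and Fatou's lemma makes its pointwise limit the L2 limit
  of the whole sequence.\<close>

lemma L2_complete:
  assumes "prob_space \<mu>" and y: "\<And>n::nat. y n \<in> L2 \<mu>"
    and Cauchy: "\<And>e. e > 0 \<Longrightarrow> \<exists>N. \<forall>m\<ge>N. \<forall>n\<ge>N. L2norm \<mu> (\<lambda>x. y m x - y n x) < e"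
  obtains z where "z \<in> L2 \<mu>" "L2_tendsto \<mu> y z"
proof -
  interpret prob_space \<mu> by fact
  have [measurable]: "y n \<in> borel_measurable \<mu>" for n using y by (rule L2_measurable)
  have ydiff: "(\<lambda>x. y m x - y n x) \<in> L2 \<mu>" for m n using y by (intro L2_diff)
  have sq1: "integrable \<mu> f" if "integrable \<mu> (\<lambda>x. (norm (f x))\<^sup>2)" "f \<in> borel_measurable \<mu>"
    for f :: "'a \<Rightarrow> 'a"
  proof (rule Bochner_Integration.integrable_bound)
    show "integrable \<mu> (\<lambda>x. 1 + (norm (f x))\<^sup>2)" using that by simp
    have "t \<le> 1 + t\<^sup>2" if "0 \<le> t" for t :: real
      using sum_squares_bound[of t 1] that by simp
    then show "AE x in \<mu>. norm (f x) \<le> norm (1 + (norm (f x))\<^sup>2)"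
      by (intro AE_I2) simp
  qed fact
  have L1: "(\<integral>x. norm (f x) \<partial>\<mu>) \<le> L2norm \<mu> f" if "f \<in> L2 \<mu>" for f :: "'a \<Rightarrow> 'a"
  proof -
    have i: "integrable \<mu> (\<lambda>x. norm (f x))" using that sq1 by (auto simp: L2_def)
    \<comment> \<open>Jensen's inequality, read off from the nonnegative variance of
      \<open>norm (f x)\<close>.\<close>
    have "0 \<le> (\<integral>x. (norm (f x) - (\<integral>x. norm (f x) \<partial>\<mu>))\<^sup>2 \<partial>\<mu>)" by simp
    also have "\<dots> = (\<integral>x. (norm (f x))\<^sup>2 \<partial>\<mu>) - (\<integral>x. norm (f x) \<partial>\<mu>)\<^sup>2"
      using i that by (intro variance_eq) (auto simp: L2_def)
    finally show ?thesis unfolding L2norm_def by (intro real_le_rsqrt) simp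
  qed
  have yi: "integrable \<mu> (y n)" for n
    by (intro sq1 L2_integrable y L2_measurable)
  have yC: "\<exists>N. \<forall>i\<ge>N. \<forall>j\<ge>N. (LINT x|\<mu>. norm (y i x - y j x)) < e" if "e > 0" for e
    using Cauchy[OF that] L1[OF ydiff] by (meson le_less_trans)
  obtain r where r: "strict_mono r" "AE x in \<mu>. Cauchy (\<lambda>i. y (r i) x)"
    by (rule cauchy_L1_AE_cauchy_subseq[OF yi yC])
  define z where "z x = lim (\<lambda>i. y (r i) x)" for x
  have [measurable]: "z \<in> borel_measurable \<mu>" unfolding z_def by measurable
  have lim: "AE x in \<mu>. (\<lambda>i. y (r i) x) \<longlonglongrightarrow> z x"
    using r(2) by eventually_elim (simp add: z_def Cauchy_convergent convergent_LIMSEQ_iff[symmetric])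
  \<comment> \<open>Fatou is applied along \<open>r\<close> with \<open>m\<close> held fixed, so the
    bound reaches every \<open>m \<ge> N\<close> and not only members of the subsequence.\<close>
  have key: "(\<integral>\<^sup>+ x. ennreal ((norm (y m x - z x))\<^sup>2) \<partial>\<mu>) \<le> ennreal (e\<^sup>2)"
    if e: "e > 0" and N: "\<forall>m\<ge>N. \<forall>n\<ge>N. L2norm \<mu> (\<lambda>x. y m x - y n x) < e" and "m \<ge> N" for e N m
  proof -
    have "(\<integral>\<^sup>+ x. ennreal ((norm (y m x - z x))\<^sup>2) \<partial>\<mu>)
      = (\<integral>\<^sup>+ x. liminf (\<lambda>i. ennreal ((norm (y m x - y (r i) x))\<^sup>2)) \<partial>\<mu>)"
    proof (rule nn_integral_cong_AE)
      show "AE x in \<mu>. ennreal ((norm (y m x - z x))\<^sup>2)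
          = liminf (\<lambda>i. ennreal ((norm (y m x - y (r i) x))\<^sup>2))"
        using lim
      proof eventually_elim
        case (elim x)
        have "(\<lambda>i. ennreal ((norm (y m x - y (r i) x))\<^sup>2)) \<longlonglongrightarrow> ennreal ((norm (y m x - z x))\<^sup>2)"
          by (intro tendsto_intros tendsto_ennrealI elim)
        then show ?case by (metis lim_imp_Liminf sequentially_bot)
      qed
    qed
    also have "\<dots> \<le> liminf (\<lambda>i. \<integral>\<^sup>+ x. ennreal ((norm (y m x - y (r i) x))\<^sup>2) \<partial>\<mu>)"
      by (intro nn_integral_liminf) measurable
    also have "\<dots> \<le> ennreal (e\<^sup>2)"
    proof (rule Liminf_le)
      have "(\<integral>\<^sup>+ x. ennreal ((norm (y m x - y (r i) x))\<^sup>2) \<partial>\<mu>) \<le> ennreal (e\<^sup>2)" if "i \<ge> N" for i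
      proof -
        have "r i \<ge> N" using seq_suble[OF r(1), of i] that by simp
        then have "L2norm \<mu> (\<lambda>x. y m x - y (r i) x) \<le> e" using N \<open>m \<ge> N\<close> by (simp add: less_imp_le)
        then have "(L2norm \<mu> (\<lambda>x. y m x - y (r i) x))\<^sup>2 \<le> e\<^sup>2"
          by (intro power_mono L2norm_nonneg)
        then show ?thesis using L2_integrable[OF ydiff]
          by (subst nn_integral_eq_integral) (auto simp: L2norm_power2 intro: ennreal_leI)
      qed
      then show "\<forall>\<^sub>F i in sequentially. (\<integral>\<^sup>+ x. ennreal ((norm (y m x - y (r i) x))\<^sup>2) \<partial>\<mu>) \<le> ennreal (e\<^sup>2)"
        using eventually_sequentially by blast
    qed simp
    finally show ?thesis .
  qed
  have diffL2: "(\<lambda>x. y m x - z x) \<in> L2 \<mu> \<and> L2norm \<mu> (\<lambda>x. y m x - z x) \<le> e"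
    if e: "e > 0" and N: "\<forall>m\<ge>N. \<forall>n\<ge>N. L2norm \<mu> (\<lambda>x. y m x - y n x) < e" and m: "m \<ge> N" for e N m
  proof
    have "integrable \<mu> (\<lambda>x. (norm (y m x - z x))\<^sup>2)"
      using key[OF e N m] by (intro integrableI_bounded) (auto simp: le_less_trans)
    then show "(\<lambda>x. y m x - z x) \<in> L2 \<mu>" by (simp add: L2_def)
    have "(\<integral>x. (norm (y m x - z x))\<^sup>2 \<partial>\<mu>) \<le> e\<^sup>2"
      using key[OF e N m] by (intro integral_real_bounded) auto
    then show "L2norm \<mu> (\<lambda>x. y m x - z x) \<le> e"
      using e unfolding L2norm_def by (intro real_le_lsqrt) auto
  qed
  obtain N where "\<forall>m\<ge>N. \<forall>n\<ge>N. L2norm \<mu> (\<lambda>x. y m x - y n x) < 1" using Cauchy[of 1] by auto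
  \<comment> \<open>Here \<open>z\<close> is recovered as \<open>y N - (y N - z)\<close>.\<close>
  from L2_diff[OF y conjunct1[OF diffL2[OF _ this order_refl]], of N]
  have "z \<in> L2 \<mu>" by simp
  moreover have "L2_tendsto \<mu> y z"
    unfolding L2_tendsto_def
  proof (rule LIMSEQ_I)
    fix e :: real assume "e > 0"
    then obtain N where "\<forall>m\<ge>N. \<forall>n\<ge>N. L2norm \<mu> (\<lambda>x. y m x - y n x) < e / 2"
      using Cauchy[of "e/2"] by auto
    with diffL2[OF _ this] \<open>e > 0\<close>
    show "\<exists>N. \<forall>m\<ge>N. norm (L2norm \<mu> (\<lambda>x. y m x - z x) - 0) < e"
      by (force simp: L2norm_nonneg)
  qed
  ultimately show thesis by (rule that)
qed

section \<open>Convex functions and the convexity of the set of their gradients\<close>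

text \<open>On the segment from \<open>x\<close> to \<open>z\<close> convexity bounds every
  difference quotient by \<open>\<phi> z - \<phi> x\<close>; the step then tends to 0 from the
  right.\<close>

lemma convex_tangent:
  fixes x z d :: "'a::euclidean_space"
  assumes "convex_on S \<phi>" "x \<in> S" "z \<in> S" "GDERIV \<phi> x :> d"
  shows "\<phi> x + d \<bullet> (z - x) \<le> \<phi> z"
proof -
  define f where "f t = x + t *\<^sub>R (z - x)" for t
  have f: "(f has_derivative (\<lambda>t. t *\<^sub>R (z - x))) (at 0)"
    unfolding f_def by (auto intro!: derivative_eq_intros)
  have "(\<phi> has_derivative (\<lambda>h. h \<bullet> d)) (at (f 0))"
    using assms(4) by (simp add: gderiv_def f_def)
  from has_derivative_compose[OF f this]
  have "((\<lambda>t. \<phi> (f t)) has_real_derivative d \<bullet> (z - x)) (at 0)"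
    by (simp add: has_field_derivative_def inner_commute[of d] mult.commute[of _ "(z - x) \<bullet> d"]
        mult_commute_abs)
  then have "((\<lambda>t. (\<phi> (f t) - \<phi> x) / t) \<longlongrightarrow> d \<bullet> (z - x)) (at 0)"
    by (simp add: has_field_derivative_iff f_def)
  then have "((\<lambda>t. (\<phi> (f t) - \<phi> x) / t) \<longlongrightarrow> d \<bullet> (z - x)) (at_right 0)"
    by (rule filterlim_mono) (auto intro: at_le)
  moreover have "\<forall>\<^sub>F t in at_right 0. (\<phi> (f t) - \<phi> x) / t \<le> \<phi> z - \<phi> x"
  proof (rule eventually_at_rightI[of 0 1])
    fix t :: real assume t: "t \<in> {0<..<1}"
    have "\<phi> ((1 - t) *\<^sub>R x + t *\<^sub>R z) \<le> (1 - t) * \<phi> x + t * \<phi> z"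
      using t assms by (intro convex_onD[OF assms(1)]) auto
    moreover have "f t = (1 - t) *\<^sub>R x + t *\<^sub>R z" by (simp add: f_def algebra_simps)
    ultimately have "\<phi> (f t) \<le> (1 - t) * \<phi> x + t * \<phi> z" by simp
    then show "(\<phi> (f t) - \<phi> x) / t \<le> \<phi> z - \<phi> x" using t by (simp add: field_simps)
  qed simp
  ultimately have "d \<bullet> (z - x) \<le> \<phi> z - \<phi> x"
    by (rule tendsto_upperbound) simp
  then show ?thesis by simp
qed

lemma convex_gradients_L2: "T \<in> convex_gradients \<mu> \<Longrightarrow> T \<in> L2 \<mu>"
  by (simp add: convex_gradients_def)

text \<open>The same combination of the two potentials works on the intersection of their domains.
  This makes segments in \<open>convex_gradients\<close> admissible competitors in the proximal
  problem.\<close>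

lemma convex_gradients_convex:
  assumes "T\<^sub>1 \<in> convex_gradients \<mu>" "T\<^sub>2 \<in> convex_gradients \<mu>" "0 \<le> t" "t \<le> 1"
  shows "(\<lambda>x. (1 - t) *\<^sub>R T\<^sub>1 x + t *\<^sub>R T\<^sub>2 x) \<in> convex_gradients \<mu>"
proof -
  obtain S\<^sub>1 \<phi>\<^sub>1 where 1: "convex_on S\<^sub>1 \<phi>\<^sub>1" "AE x in \<mu>. x \<in> interior S\<^sub>1 \<and> GDERIV \<phi>\<^sub>1 x :> T\<^sub>1 x"
    using assms(1) by (auto simp: convex_gradients_def)
  obtain S\<^sub>2 \<phi>\<^sub>2 where 2: "convex_on S\<^sub>2 \<phi>\<^sub>2" "AE x in \<mu>. x \<in> interior S\<^sub>2 \<and> GDERIV \<phi>\<^sub>2 x :> T\<^sub>2 x"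
    using assms(2) by (auto simp: convex_gradients_def)
  have "convex (S\<^sub>1 \<inter> S\<^sub>2)"
    using 1 2 by (intro convex_Int) (auto simp: convex_on_def)
  then have "convex_on (S\<^sub>1 \<inter> S\<^sub>2) (\<lambda>x. (1 - t) * \<phi>\<^sub>1 x + t * \<phi>\<^sub>2 x)"
    using assms(3,4) by (intro convex_on_add convex_on_cmul convex_on_subset[OF 1(1)]
        convex_on_subset[OF 2(1)]) auto
  moreover have "AE x in \<mu>. x \<in> interior (S\<^sub>1 \<inter> S\<^sub>2) \<and>
      GDERIV (\<lambda>x. (1 - t) * \<phi>\<^sub>1 x + t * \<phi>\<^sub>2 x) x :> (1 - t) *\<^sub>R T\<^sub>1 x + t *\<^sub>R T\<^sub>2 x"
    using 1(2) 2(2)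
  proof eventually_elim
    case (elim x)
    have *: "GDERIV (\<lambda>x. c * f x) x :> c *\<^sub>R d" if "GDERIV f x :> d" for c d and f :: "'a \<Rightarrow> real"
      using that unfolding gderiv_def inner_scaleR_right by (rule has_derivative_mult_right)
    show ?case using elim by (auto intro!: GDERIV_add *)
  qed
  ultimately show ?thesis
    using assms unfolding convex_gradients_def
    by (blast intro: L2_lincomb)
qed

section \<open>Pushforwards, couplings and optimality of convex gradients\<close>

lemma distr_P2:
  assumes "\<mu> \<in> P2" "T \<in> L2 \<mu>"
  shows "distr \<mu> borel T \<in> P2"
proof -
  have [measurable]: "T \<in> borel_measurable \<mu>" using assms(2) by (rule L2_measurable)
  interpret prob_space \<mu> using assms(1) by (rule P2_prob)
  show ?thesis using assms(2)
    by (simp add: P2_def prob_space_distr integrable_distr_eq L2_integrable)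
qed

text \<open>The marginals fix the second moments, so the cost depends on the coupling only through
  the integral of \<open>fst z \<bullet> snd z\<close>: minimal cost means maximal
  correlation.\<close>

lemma couplings_D:
  assumes "\<mu> \<in> P2" "\<nu> \<in> P2" and \<pi>: "\<pi> \<in> couplings \<mu> \<nu>"
  shows couplings_fst: "distr \<pi> borel fst = \<mu>"
    and couplings_snd: "distr \<pi> borel snd = \<nu>"
    and couplings_measurable: "fst \<in> borel_measurable \<pi>" "snd \<in> borel_measurable \<pi>"
    and couplings_integrable: "integrable \<pi> (\<lambda>z. (norm (fst z))\<^sup>2)" "integrable \<pi> (\<lambda>z. (norm (snd z))\<^sup>2)"
      "integrable \<pi> (\<lambda>z. fst z \<bullet> snd z)"
    and transport_cost_eq: "transport_cost \<pi>
      = (\<integral>x. (norm x)\<^sup>2 \<partial>\<mu>) + (\<integral>y. (norm y)\<^sup>2 \<partial>\<nu>) - 2 * (\<integral>z. fst z \<bullet> snd z \<partial>\<pi>)"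
proof -
  have sets\<pi>: "sets \<pi> = sets borel" and fst\<pi>: "distr \<pi> borel fst = \<mu>"
    and snd\<pi>: "distr \<pi> borel snd = \<nu>"
    using \<pi> by (auto simp: couplings_def)
  show "distr \<pi> borel fst = \<mu>" "distr \<pi> borel snd = \<nu>" by fact+
  show m: "fst \<in> borel_measurable \<pi>" "snd \<in> borel_measurable \<pi>"
    unfolding measurable_cong_sets[OF sets\<pi> refl]
    by (intro borel_measurable_continuous_onI continuous_intros)+
  show sq: "integrable \<pi> (\<lambda>z. (norm (fst z))\<^sup>2)" "integrable \<pi> (\<lambda>z. (norm (snd z))\<^sup>2)"
    using P2_integrable[OF assms(1)] integrable_distr_eq[OF m(1), of "\<lambda>x. (norm x)\<^sup>2"]
      P2_integrable[OF assms(2)] integrable_distr_eq[OF m(2), of "\<lambda>x. (norm x)\<^sup>2"]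
    by (auto simp: fst\<pi> snd\<pi>)
  show inner: "integrable \<pi> (\<lambda>z. fst z \<bullet> snd z)"
    by (rule integrable_inner_square[OF m sq])
  have "transport_cost \<pi> = (\<integral>z. (norm (fst z))\<^sup>2 + (norm (snd z))\<^sup>2 - 2 * (fst z \<bullet> snd z) \<partial>\<pi>)"
    unfolding transport_cost_def
    by (intro Bochner_Integration.integral_cong)
      (simp_all add: power2_norm_eq_inner inner_diff inner_commute)
  also have "\<dots> = (\<integral>z. (norm (fst z))\<^sup>2 \<partial>\<pi>) + (\<integral>z. (norm (snd z))\<^sup>2 \<partial>\<pi>)
      - 2 * (\<integral>z. fst z \<bullet> snd z \<partial>\<pi>)"
    using sq inner by simp
  also have "(\<integral>z. (norm (fst z))\<^sup>2 \<partial>\<pi>) = (\<integral>x. (norm x)\<^sup>2 \<partial>\<mu>)"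
    using integral_distr[OF m(1), of "\<lambda>x. (norm x)\<^sup>2"] by (simp add: fst\<pi>)
  also have "(\<integral>z. (norm (snd z))\<^sup>2 \<partial>\<pi>) = (\<integral>x. (norm x)\<^sup>2 \<partial>\<nu>)"
    using integral_distr[OF m(2), of "\<lambda>x. (norm x)\<^sup>2"] by (simp add: snd\<pi>)
  finally show "transport_cost \<pi>
      = (\<integral>x. (norm x)\<^sup>2 \<partial>\<mu>) + (\<integral>y. (norm y)\<^sup>2 \<partial>\<nu>) - 2 * (\<integral>z. fst z \<bullet> snd z \<partial>\<pi>)" .
qed

text \<open>The easy half of Kantorovich duality: Young's inequality for \<open>\<phi>\<close> and its Legendre transform
  \<open>\<psi>\<close>, with equality on the graph of \<open>T\<close>.\<close>

lemma integral_inner_coupling_le: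
  assumes \<mu>: "\<mu> \<in> P2" and T: "T \<in> convex_gradients \<mu>"
    and \<pi>: "\<pi> \<in> couplings \<mu> (distr \<mu> borel T)"
  shows "(\<integral>z. fst z \<bullet> snd z \<partial>\<pi>) \<le> (\<integral>x. x \<bullet> T x \<partial>\<mu>)"
proof -
  interpret prob_space \<mu> using \<mu> by (rule P2_prob)
  have sets\<mu>[measurable_cong]: "sets \<mu> = sets borel" using \<mu> by (rule P2_sets)
  have TL2: "T \<in> L2 \<mu>" using T by (rule convex_gradients_L2)
  have [measurable]: "T \<in> borel_measurable \<mu>" using TL2 by (rule L2_measurable)
  obtain S \<phi> where "convex_on S \<phi>" and grad: "AE x in \<mu>. x \<in> interior S \<and> GDERIV \<phi> x :> T x"
    using T by (auto simp: convex_gradients_def)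
  \<comment> \<open>On an open domain \<open>\<phi>\<close> is continuous, hence Borel, and the
    interior still carries full measure.\<close>
  define U where "U = interior S"
  have convU: "convex_on U \<phi>"
    using \<open>convex_on S \<phi>\<close> unfolding U_def
    by (rule convex_on_subset) (auto simp: interior_subset convex_on_imp_convex[OF \<open>convex_on S \<phi>\<close>])
  have openU: "open U" by (simp add: U_def)
  \<comment> \<open>By the tangent inequality, \<open>x\<close> itself attains the supremum that
    defines the transform at \<open>T x\<close>.\<close>
  have young_eq: "AE x in \<mu>. x \<in> U \<and> (\<forall>z\<in>U. z \<bullet> T x - \<phi> z \<le> x \<bullet> T x - \<phi> x)"
    using grad
  proof eventually_elim
    case (elim x)
    then show ?case using convex_tangent[OF convU, of x _ "T x"]
      by (fastforce simp: U_def inner_diff_right inner_commute)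
  qed
  \<comment> \<open>This base point supplies affine minorants of both \<open>\<phi>\<close> and
    \<open>\<psi>\<close>, used below for finiteness and integrability.\<close>
  obtain x0 where x0: "x0 \<in> U" "\<forall>z\<in>U. z \<bullet> T x0 - \<phi> z \<le> x0 \<bullet> T x0 - \<phi> x0"
    using eventually_happens[OF young_eq] AE_False not_empty by (auto simp: trivial_limit_def)
  define f where "f x = (if x \<in> U then \<phi> x else 0)" for x
  have [measurable]: "f \<in> borel_measurable borel"
    unfolding f_def using openU convex_on_continuous[OF openU convU]
    by (intro borel_measurable_continuous_on_if) auto
  \<comment> \<open>The transform may be \<open>\<infinity>\<close>, hence \<open>ereal\<close>. As
    a supremum of continuous functions it has open strict superlevel sets, so it is measurable
    although the supremum is uncountable.\<close>
  define \<psi> where "\<psi> y = (SUP z\<in>U. ereal (z \<bullet> y - \<phi> z))" for y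
  have [measurable]: "\<psi> \<in> borel_measurable borel"
  proof (rule borel_measurableI_greater)
    fix a :: ereal
    have "{x \<in> space borel. a < \<psi> x} = (\<Union>z\<in>U. {x. a < ereal (z \<bullet> x - \<phi> z)})"
      by (auto simp: \<psi>_def less_SUP_iff)
    also have "open \<dots>"
      by (intro open_UN ballI open_Collect_less continuous_intros)
    finally show "{x \<in> space borel. a < \<psi> x} \<in> sets borel" by simp
  qed
  \<comment> \<open>\<open>real_of_ereal\<close> sends \<open>\<infinity>\<close> to 0, which is why
    the inequality \<open>young\<close> carries the guard
    \<open>\<psi> y \<noteq> \<infinity>\<close>.\<close>
  define g where "g y = real_of_ereal (\<psi> y)" for y
  have [measurable]: "g \<in> borel_measurable borel" unfolding g_def by measurable
  have T_eq: "AE x in \<mu>. x \<in> U \<and> \<psi> (T x) = ereal (x \<bullet> T x - f x)"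
    using young_eq
  proof eventually_elim
    case (elim x)
    then have "\<psi> (T x) = ereal (x \<bullet> T x - \<phi> x)"
      unfolding \<psi>_def by (intro antisym SUP_least) (auto intro: SUP_upper2)
    with elim show ?case by (simp add: f_def)
  qed
  then have fin: "AE y in distr \<mu> borel T. \<psi> y \<noteq> \<infinity>"
    by (subst AE_distr_iff) auto
  have low: "ereal (x0 \<bullet> y - \<phi> x0) \<le> \<psi> y" for y
    unfolding \<psi>_def by (rule SUP_upper[OF x0(1)])
  have young: "z \<bullet> y \<le> f z + g y" if "z \<in> U" "\<psi> y \<noteq> \<infinity>" for z y
  proof -
    have "\<psi> y = ereal (g y)" using that low[of y] unfolding g_def by (cases "\<psi> y") auto
    moreover have "ereal (z \<bullet> y - \<phi> z) \<le> \<psi> y"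
      unfolding \<psi>_def by (rule SUP_upper[OF that(1)])
    ultimately show ?thesis using that by (simp add: f_def)
  qed

  have sq: "integrable \<mu> (\<lambda>x. x \<bullet> T x)"
    using L2_inner_integrable[OF L2_ident[OF \<mu>] TL2] .
  have L2_int: "integrable \<mu> (\<lambda>x. h x \<bullet> c)" if "h \<in> L2 \<mu>" for h c
  proof -
    have "(\<lambda>_. c) \<in> L2 \<mu>" by (simp add: L2_def)
    from L2_inner_integrable[OF that this] show ?thesis .
  qed
  have Tint: "integrable \<mu> (\<lambda>x. x0 \<bullet> T x)" "integrable \<mu> (\<lambda>x. x \<bullet> T x0)"
    using L2_int[OF TL2, of x0] L2_int[OF L2_ident[OF \<mu>], of "T x0"] by (simp_all add: inner_commute)
  \<comment> \<open>The upper bound on \<open>f\<close> comes from \<open>low\<close> at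
    \<open>T x\<close>, the lower bound from the tangent to \<open>\<phi>\<close> at
    \<open>x0\<close>; both bounds are integrable.\<close>
  have f_int: "integrable \<mu> f"
  proof (rule Bochner_Integration.integrable_bound)
    show "integrable \<mu> (\<lambda>x. \<bar>x \<bullet> T x - (x0 \<bullet> T x - \<phi> x0)\<bar> + \<bar>x \<bullet> T x0 - (x0 \<bullet> T x0 - \<phi> x0)\<bar>)"
      using sq Tint by simp
    show "AE x in \<mu>. norm (f x) \<le> norm (\<bar>x \<bullet> T x - (x0 \<bullet> T x - \<phi> x0)\<bar> + \<bar>x \<bullet> T x0 - (x0 \<bullet> T x0 - \<phi> x0)\<bar>)"
      using T_eq
    proof eventually_elim
      case (elim x)
      have "f x \<le> x \<bullet> T x - (x0 \<bullet> T x - \<phi> x0)" using low[of "T x"] elim by simp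
      moreover have "f x \<ge> x \<bullet> T x0 - (x0 \<bullet> T x0 - \<phi> x0)"
        using x0(2) elim by (auto simp: f_def algebra_simps)
      ultimately show ?case by simp
    qed
  qed simp
  have gT: "AE x in \<mu>. g (T x) = x \<bullet> T x - f x"
    using T_eq by eventually_elim (simp add: g_def)
  have gT_int: "integrable \<mu> (\<lambda>x. g (T x))"
    using gT sq f_int by (subst integrable_cong_AE[where g="\<lambda>x. x \<bullet> T x - f x"]) auto
  have gT_eq: "(\<integral>x. g (T x) \<partial>\<mu>) = (\<integral>x. x \<bullet> T x \<partial>\<mu>) - (\<integral>x. f x \<partial>\<mu>)"
    using gT sq f_int by (subst integral_cong_AE[where g="\<lambda>x. x \<bullet> T x - f x"]) auto

  note P2s = \<mu> distr_P2[OF \<mu> TL2] \<pi>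
  note fst\<pi> = couplings_fst[OF P2s] and snd\<pi> = couplings_snd[OF P2s]
    and m = couplings_measurable[OF P2s]
  have f_pi: "integrable \<pi> (\<lambda>z. f (fst z))" "(\<integral>z. f (fst z) \<partial>\<pi>) = (\<integral>x. f x \<partial>\<mu>)"
    using f_int integrable_distr_eq[OF m(1), of f] integral_distr[OF m(1), of f] by (auto simp: fst\<pi>)
  have g_pi: "integrable \<pi> (\<lambda>z. g (snd z))" "(\<integral>z. g (snd z) \<partial>\<pi>) = (\<integral>x. g (T x) \<partial>\<mu>)"
    using gT_int integrable_distr_eq[OF m(2), of g] integral_distr[OF m(2), of g]
      integrable_distr_eq[of T \<mu> borel g] integral_distr[of T \<mu> borel g] by (auto simp: snd\<pi>)
  \<comment> \<open>Almost sure statements about \<open>\<mu>\<close> and its image pass to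
    \<open>\<pi>\<close> through the two marginals.\<close>
  have U_pi: "AE z in \<pi>. fst z \<in> U"
  proof -
    have "AE x in distr \<pi> borel fst. x \<in> U" using young_eq unfolding fst\<pi> by eventually_elim simp
    then show ?thesis using openU by (subst (asm) AE_distr_iff[OF m(1)]) auto
  qed
  have fin_pi: "AE z in \<pi>. \<psi> (snd z) \<noteq> \<infinity>"
    using fin unfolding snd\<pi>[symmetric] by (subst (asm) AE_distr_iff[OF m(2)]) auto
  have "(\<integral>z. fst z \<bullet> snd z \<partial>\<pi>) \<le> (\<integral>z. f (fst z) + g (snd z) \<partial>\<pi>)"
    using f_pi g_pi couplings_integrable(3)[OF P2s]
  proof (intro integral_mono_AE)
    show "AE z in \<pi>. fst z \<bullet> snd z \<le> f (fst z) + g (snd z)"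
      using U_pi fin_pi by eventually_elim (rule young)
  qed auto
  also have "\<dots> = (\<integral>x. x \<bullet> T x \<partial>\<mu>)"
    using f_pi g_pi gT_eq by simp
  finally show ?thesis .
qed

lemma pair_coupling:
  assumes \<mu>: "\<mu> \<in> P2" and f: "f \<in> L2 \<mu>" and g: "g \<in> L2 \<mu>"
  shows "distr \<mu> borel (\<lambda>x. (f x, g x)) \<in> couplings (distr \<mu> borel f) (distr \<mu> borel g)"
    and "transport_cost (distr \<mu> borel (\<lambda>x. (f x, g x))) = (L2norm \<mu> (\<lambda>x. g x - f x))\<^sup>2"
proof -
  have [measurable]: "f \<in> borel_measurable \<mu>" "g \<in> borel_measurable \<mu>"
    using f g by (auto simp: L2_D)
  have m: "(fst :: 'a \<times> 'a \<Rightarrow> 'a) \<in> borel_measurable borel"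
    "(snd :: 'a \<times> 'a \<Rightarrow> 'a) \<in> borel_measurable borel"
    by (intro borel_measurable_continuous_onI continuous_intros)+
  have fg: "(\<lambda>x. (f x, g x)) \<in> borel_measurable \<mu>" by measurable
  show "distr \<mu> borel (\<lambda>x. (f x, g x)) \<in> couplings (distr \<mu> borel f) (distr \<mu> borel g)"
    using distr_distr[OF m(1) fg] distr_distr[OF m(2) fg] by (simp add: couplings_def comp_def)
  have "(\<lambda>z::'a \<times> 'a. (norm (snd z - fst z))\<^sup>2) \<in> borel_measurable borel"
    by (intro borel_measurable_continuous_onI continuous_intros)
  from integral_distr[OF fg this]
  show "transport_cost (distr \<mu> borel (\<lambda>x. (f x, g x))) = (L2norm \<mu> (\<lambda>x. g x - f x))\<^sup>2"
    by (simp add: transport_cost_def L2norm_power2)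
qed

text \<open>Two images are coupled through a common source point. Strong convergence of maps
  therefore gives \<open>W2\<close> convergence of the image measures.\<close>

lemma W2_distr_le:
  assumes "\<mu> \<in> P2" "f \<in> L2 \<mu>" "g \<in> L2 \<mu>"
  shows "W2 (distr \<mu> borel f) (distr \<mu> borel g) \<le> L2norm \<mu> (\<lambda>x. g x - f x)"
proof -
  have "bdd_below (transport_cost ` couplings (distr \<mu> borel f) (distr \<mu> borel g))"
    by (intro bdd_belowI[of _ 0]) (auto simp: transport_cost_def)
  from cINF_lower[OF this pair_coupling(1)[OF assms]] show ?thesis
    unfolding W2_def pair_coupling(2)[OF assms]
    by (intro real_le_lsqrt L2norm_nonneg) auto
qed

text \<open>The coupling carried by the graph of \<open>T\<close> attains the correlation bound of
  \<open>integral_inner_coupling_le\<close>. Hence any two elements of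
  \<open>convex_gradients\<close> span a generalized geodesic with anchor
  \<open>\<mu>\<close>.\<close>

lemma convex_gradient_optimal:
  assumes \<mu>: "\<mu> \<in> P2" and T: "T \<in> convex_gradients \<mu>"
  shows "is_optimal_map \<mu> (distr \<mu> borel T) T"
proof -
  have TL2: "T \<in> L2 \<mu>" using T by (rule convex_gradients_L2)
  let ?\<pi> = "distr \<mu> borel (\<lambda>x. (x, T x))"
  have "distr \<mu> borel (\<lambda>x. x) = \<mu>"
    using P2_sets[OF \<mu>] distr_cong[of \<mu> \<mu> borel \<mu> "\<lambda>x. x" "\<lambda>x. x"] distr_id[of \<mu>] by (simp add: id_def)
  then have c: "?\<pi> \<in> couplings \<mu> (distr \<mu> borel T)"
    using pair_coupling(1)[OF \<mu> L2_ident[OF \<mu>] TL2] by simp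
  have [measurable]: "T \<in> borel_measurable \<mu>" using TL2 by (rule L2_measurable)
  have [measurable_cong]: "sets \<mu> = sets borel" using \<mu> by (rule P2_sets)
  have "(\<lambda>x. (x, T x)) \<in> borel_measurable \<mu>" by measurable
  moreover have "(\<lambda>z::'a \<times> 'a. fst z \<bullet> snd z) \<in> borel_measurable borel"
    by (intro borel_measurable_continuous_onI continuous_intros)
  ultimately have int: "(\<integral>z. fst z \<bullet> snd z \<partial>?\<pi>) = (\<integral>x. x \<bullet> T x \<partial>\<mu>)"
    by (simp add: integral_distr)
  have "transport_cost ?\<pi> \<le> transport_cost \<pi>" if "\<pi> \<in> couplings \<mu> (distr \<mu> borel T)" for \<pi>
    using integral_inner_coupling_le[OF \<mu> T that] int
      transport_cost_eq[OF \<mu> distr_P2[OF \<mu> TL2] that] transport_cost_eq[OF \<mu> distr_P2[OF \<mu> TL2] c]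
    by simp
  with c T show ?thesis
    by (auto simp: is_optimal_map_def optimal_plans_def is_arg_min_linorder)
qed

section \<open>Convexity along generalized geodesics and the proximal step\<close>

text \<open>Turns the hypothesis on measures into \<open>lam\<close>-convexity of
  \<open>D (distr \<mu> borel S)\<close> as a function of the map \<open>S\<close>.\<close>

lemma gen_geodesic_convexD:
  assumes "convex_along_gen_geodesics lam \<mu> D" and \<mu>: "\<mu> \<in> P2"
    and "S\<^sub>1 \<in> convex_gradients \<mu>" "S\<^sub>2 \<in> convex_gradients \<mu>" "0 \<le> t" "t \<le> 1"
  shows "D (distr \<mu> borel (\<lambda>x. (1 - t) *\<^sub>R S\<^sub>1 x + t *\<^sub>R S\<^sub>2 x))
    \<le> (1 - t) * D (distr \<mu> borel S\<^sub>1) + t * D (distr \<mu> borel S\<^sub>2)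
      - lam / 2 * t * (1 - t) * (L2norm \<mu> (\<lambda>x. S\<^sub>1 x - S\<^sub>2 x))\<^sup>2"
  using assms convex_gradient_optimal[OF \<mu>] distr_P2[OF \<mu> convex_gradients_L2]
  unfolding convex_along_gen_geodesics_def by simp

text \<open>The objective is \<open>(lam + c)\<close>-convex along the segment from \<open>P\<close>
  to \<open>S\<close>; comparing \<open>P\<close> with nearby points of that segment yields the
  extra quadratic term. The lemma serves twice: with \<open>c = 1 / \<tau>\<close> for the scheme
  and with \<open>c = 0\<close> for quadratic growth around the minimizer.\<close>

lemma proximal_inequality:
  assumes conv: "convex_along_gen_geodesics lam \<mu> D" and \<mu>: "\<mu> \<in> P2"
    and P: "P \<in> convex_gradients \<mu>" and S: "S \<in> convex_gradients \<mu>" and Q: "Q \<in> L2 \<mu>"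
    and min: "\<And>U. U \<in> convex_gradients \<mu> \<Longrightarrow>
      D (distr \<mu> borel P) + c / 2 * (L2norm \<mu> (\<lambda>x. P x - Q x))\<^sup>2
      \<le> D (distr \<mu> borel U) + c / 2 * (L2norm \<mu> (\<lambda>x. U x - Q x))\<^sup>2"
  shows "D (distr \<mu> borel P) + c / 2 * (L2norm \<mu> (\<lambda>x. P x - Q x))\<^sup>2
      + (lam + c) / 2 * (L2norm \<mu> (\<lambda>x. P x - S x))\<^sup>2
    \<le> D (distr \<mu> borel S) + c / 2 * (L2norm \<mu> (\<lambda>x. S x - Q x))\<^sup>2"
proof -
  define A B E where "A = (L2norm \<mu> (\<lambda>x. P x - Q x))\<^sup>2" "B = (L2norm \<mu> (\<lambda>x. S x - Q x))\<^sup>2"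
    "E = (L2norm \<mu> (\<lambda>x. P x - S x))\<^sup>2"
  define p s where "p = D (distr \<mu> borel P)" "s = D (distr \<mu> borel S)"
  have L2: "(\<lambda>x. P x - Q x) \<in> L2 \<mu>" "(\<lambda>x. S x - Q x) \<in> L2 \<mu>"
    using P S Q by (auto intro: L2_diff convex_gradients_L2)
  have bound: "p + c / 2 * A + (lam + c) / 2 * E * (1 - t) \<le> s + c / 2 * B"
    if t: "0 < t" "t < 1" for t
  proof -
    define U where "U x = (1 - t) *\<^sub>R P x + t *\<^sub>R S x" for x
    have U: "U \<in> convex_gradients \<mu>"
      using P S t unfolding U_def by (intro convex_gradients_convex) auto
    define v where "v = (\<integral>x. (P x - Q x) \<bullet> (S x - Q x) \<partial>\<mu>)"
    have "(\<lambda>x. U x - Q x) = (\<lambda>x. (1 - t) *\<^sub>R (P x - Q x) + t *\<^sub>R (S x - Q x))"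
      by (simp add: U_def algebra_simps)
    then have U_eq: "(L2norm \<mu> (\<lambda>x. U x - Q x))\<^sup>2 = (1 - t)\<^sup>2 * A + 2 * (1 - t) * t * v + t\<^sup>2 * B"
      unfolding A_B_E_def v_def by (simp only: L2norm_lincomb_power2[OF L2])
    have E_eq: "E = A - 2 * v + B"
      using L2norm_diff_power2[OF L2] by (simp add: A_B_E_def v_def)
    \<comment> \<open>An exact identity for the squared distance to \<open>Q\<close> along a
      segment; it contributes the \<open>c\<close> in \<open>lam + c\<close>.\<close>
    have U_A_B_E: "(L2norm \<mu> (\<lambda>x. U x - Q x))\<^sup>2 = (1 - t) * A + t * B - t * (1 - t) * E"
      unfolding U_eq E_eq by (simp add: power2_eq_square algebra_simps)
    have "p + c / 2 * A \<le> D (distr \<mu> borel U) + c / 2 * (L2norm \<mu> (\<lambda>x. U x - Q x))\<^sup>2"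
      using min[OF U] unfolding A_B_E_def p_s_def .
    also have "D (distr \<mu> borel U) \<le> (1 - t) * p + t * s - lam / 2 * t * (1 - t) * E"
      using gen_geodesic_convexD[OF conv \<mu> P S, of t] t unfolding A_B_E_def p_s_def U_def by simp
    finally have "p + c / 2 * A \<le> (1 - t) * p + t * s - lam / 2 * t * (1 - t) * E
        + c / 2 * ((1 - t) * A + t * B - t * (1 - t) * E)"
      unfolding U_A_B_E by simp
    \<comment> \<open>The terms with factor \<open>1 - t\<close> cancel against the left side,
      leaving a common factor \<open>t\<close> to divide by before \<open>t\<close> tends to
      0.\<close>
    then have "t * (p + c / 2 * A + (lam + c) / 2 * E * (1 - t)) \<le> t * (s + c / 2 * B)"
      by (simp add: field_simps)
    then show ?thesis using t by simp
  qed
  have "((\<lambda>t. p + c / 2 * A + (lam + c) / 2 * E * (1 - t)) \<longlongrightarrow>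
      p + c / 2 * A + (lam + c) / 2 * E * (1 - 0)) (at_right 0)"
    by (intro tendsto_intros)
  then have "p + c / 2 * A + (lam + c) / 2 * E * (1 - 0) \<le> s + c / 2 * B"
    by (rule tendsto_upperbound) (use bound in \<open>auto intro!: eventually_at_rightI[of 0 1]\<close>)
  then show ?thesis by (simp add: A_B_E_def p_s_def)
qed

text \<open>Young's inequality \<open>C \<le> (1 + s) A + (1 + 1/s) B\<close> replaces the triangle inequality.\<close>

lemma proximal_contraction:
  assumes L2: "P \<in> L2 \<mu>" "Q \<in> L2 \<mu>" "R \<in> L2 \<mu>" and s: "s > 0"
    and le: "(1 + 2 * s) * (L2norm \<mu> (\<lambda>x. P x - R x))\<^sup>2 + (L2norm \<mu> (\<lambda>x. P x - Q x))\<^sup>2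
      \<le> (L2norm \<mu> (\<lambda>x. Q x - R x))\<^sup>2"
  shows "(1 + s) * L2norm \<mu> (\<lambda>x. P x - R x) \<le> L2norm \<mu> (\<lambda>x. Q x - R x)"
proof -
  define A B C where "A = (L2norm \<mu> (\<lambda>x. P x - R x))\<^sup>2" "B = (L2norm \<mu> (\<lambda>x. P x - Q x))\<^sup>2"
    "C = (L2norm \<mu> (\<lambda>x. Q x - R x))\<^sup>2"
  define c where "c = (\<integral>x. (P x - R x) \<bullet> (P x - Q x) \<partial>\<mu>)"
  have d: "(\<lambda>x. P x - R x) \<in> L2 \<mu>" "(\<lambda>x. P x - Q x) \<in> L2 \<mu>" using L2 by (auto intro: L2_diff)
  have C: "C = A - 2 * c + B"
    using L2norm_diff_power2[OF d] by (simp add: A_B_C_def c_def)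
  \<comment> \<open>Young's inequality in disguise: a squared norm bounds the cross term
    \<open>c\<close> from below.\<close>
  have "0 \<le> s\<^sup>2 * A + 2 * s * c + B"
  proof -
    have "0 \<le> (L2norm \<mu> (\<lambda>x. s *\<^sub>R (P x - R x) + 1 *\<^sub>R (P x - Q x)))\<^sup>2" by simp
    also have "\<dots> = s\<^sup>2 * A + 2 * s * c + B"
      unfolding L2norm_lincomb_power2[OF d] A_B_C_def c_def by simp
    finally show ?thesis .
  qed
  then have "s * C \<le> s * (1 + s) * A + (1 + s) * B"
    unfolding C by (simp add: power2_eq_square algebra_simps)
  \<comment> \<open>The factor \<open>1 + s\<close> gives \<open>B\<close> the same coefficient as
    in the previous bound, so it cancels, and
    \<open>(1 + s) * (1 + 2 * s) - s * (1 + s) = (1 + s)\<^sup>2\<close>.\<close>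
  moreover have "(1 + s) * ((1 + 2 * s) * A + B) \<le> (1 + s) * C"
    using le s unfolding A_B_C_def by (intro mult_left_mono) auto
  ultimately have "(1 + s)\<^sup>2 * A \<le> C"
    by (simp add: power2_eq_square algebra_simps)
  then have "((1 + s) * L2norm \<mu> (\<lambda>x. P x - R x))\<^sup>2 \<le> (L2norm \<mu> (\<lambda>x. Q x - R x))\<^sup>2"
    unfolding A_B_C_def by (simp add: power_mult_distrib)
  then show ?thesis by (rule power2_le_imp_le) (rule L2norm_nonneg)
qed

section \<open>Minimizing sequences and weak convergence\<close>

text \<open>By \<open>W2_distr_le\<close> the image measures converge in \<open>W2\<close>, the
  topology of the semicontinuity assumption.\<close>

lemma lsc_L2_limit:
  assumes \<mu>: "\<mu> \<in> P2" and lsc: "W2_lower_semicontinuous D"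
    and y: "\<And>n. y n \<in> L2 \<mu>" and z: "z \<in> L2 \<mu>" and lim: "L2_tendsto \<mu> y z"
    and le: "\<And>n. D (distr \<mu> borel (y n)) \<le> m + e n" and e: "e \<longlonglongrightarrow> 0"
  shows "D (distr \<mu> borel z) \<le> m"
proof (rule field_le_epsilon)
  fix \<epsilon> :: real assume "\<epsilon> > 0"
  then obtain \<delta> where \<delta>: "\<delta> > 0"
    "\<And>\<nu>. \<nu> \<in> P2 \<Longrightarrow> W2 (distr \<mu> borel z) \<nu> < \<delta> \<Longrightarrow> D \<nu> > D (distr \<mu> borel z) - \<epsilon> / 2"
    using lsc distr_P2[OF \<mu> z] unfolding W2_lower_semicontinuous_def
    by (metis half_gt_zero)
  have "\<forall>\<^sub>F n in sequentially. L2norm \<mu> (\<lambda>x. y n x - z x) < \<delta>"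
    using lim \<delta>(1) unfolding L2_tendsto_def by (rule order_tendstoD)
  moreover have "\<forall>\<^sub>F n in sequentially. e n < \<epsilon> / 2"
    using e \<open>\<epsilon> > 0\<close> by (intro order_tendstoD) auto
  ultimately have "\<forall>\<^sub>F n in sequentially. D (distr \<mu> borel z) \<le> m + \<epsilon>"
  proof eventually_elim
    case (elim n)
    have "D (distr \<mu> borel (y n)) > D (distr \<mu> borel z) - \<epsilon> / 2"
      using elim W2_distr_le[OF \<mu> z y] by (intro \<delta>(2) distr_P2 \<mu> y) (auto intro: le_less_trans)
    with le[of n] elim show ?case by simp
  qed
  then show "D (distr \<mu> borel z) \<le> m + \<epsilon>" by simp
qed

text \<open>All three maps have the same norm, so strict convexity of the norm applies.\<close>

lemma eq_of_midpoint_law: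
  assumes f: "f \<in> L2 \<mu>" and g: "g \<in> L2 \<mu>"
    and "distr \<mu> borel f = \<nu>" "distr \<mu> borel g = \<nu>"
      "distr \<mu> borel (\<lambda>x. (1 / 2) *\<^sub>R f x + (1 / 2) *\<^sub>R g x) = \<nu>"
  shows "L2norm \<mu> (\<lambda>x. f x - g x) = 0"
proof -
  have N: "(L2norm \<mu> h)\<^sup>2 = (\<integral>y. (norm y)\<^sup>2 \<partial>\<nu>)" if "h \<in> L2 \<mu>" "distr \<mu> borel h = \<nu>" for h
    using integral_distr[OF L2_measurable[OF that(1)], of "\<lambda>y. (norm y)\<^sup>2"] that(2)
    by (simp add: L2norm_power2)
  have "(L2norm \<mu> (\<lambda>x. f x - g x))\<^sup>2 = 0"
    using L2norm_diff_power2[OF f g] L2norm_lincomb_power2[OF f g, of "1/2" "1/2"]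
      N[OF f] N[OF g] N[OF L2_lincomb[OF f g, of "1/2" "1/2"]] assms(3-)
    by (simp add: power2_eq_square)
  then show ?thesis by simp
qed

text \<open>Elements of almost minimal norm form a Cauchy sequence by the parallelogram identity. This
  replaces weak compactness combined with Mazur's lemma.\<close>

lemma convergent_selection_nested_convex:
  assumes "prob_space \<mu>" and L2: "\<And>n. C n \<subseteq> L2 \<mu>" and dec: "decseq C"
    and mid: "\<And>n f g. f \<in> C n \<Longrightarrow> g \<in> C n \<Longrightarrow> (\<lambda>x. (1 / 2) *\<^sub>R f x + (1 / 2) *\<^sub>R g x) \<in> C n"
    and bounded: "\<And>n. \<exists>f\<in>C n. (L2norm \<mu> f)\<^sup>2 \<le> R"
  obtains y z where "\<And>n. y n \<in> C n" "z \<in> L2 \<mu>" "L2_tendsto \<mu> y z"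
proof -
  \<comment> \<open>The squared distance of \<open>C n\<close> from the origin grows as the sets
    shrink and stays below \<open>R\<close>, so it converges.\<close>
  define d where "d n = (INF f\<in>C n. (L2norm \<mu> f)\<^sup>2)" for n
  have bdd: "bdd_below ((\<lambda>f. (L2norm \<mu> f)\<^sup>2) ` C n)" for n
    by (intro bdd_belowI[of _ 0]) auto
  have d_le: "d n \<le> (L2norm \<mu> f)\<^sup>2" if "f \<in> C n" for n f
    unfolding d_def using bdd that by (rule cINF_lower)
  have ne: "C n \<noteq> {}" for n using bounded[of n] by auto
  have "d n \<le> R" for n using bounded[of n] d_le by (meson order_trans)
  moreover have "incseq d"
  proof (rule incseq_SucI)
    show "d n \<le> d (Suc n)" for n
      unfolding d_def using decseqD[OF dec, of n "Suc n"]
      by (intro cINF_superset_mono ne bdd) auto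
  qed
  ultimately obtain L where L: "d \<longlonglongrightarrow> L" "\<And>n. d n \<le> L"
    using incseq_convergent[of d R] by blast
  have "\<exists>f\<in>C n. (L2norm \<mu> f)\<^sup>2 < d n + 1 / real (Suc n)" for n
  proof -
    have "d n < d n + 1 / real (Suc n)" by simp
    then show ?thesis unfolding d_def using cINF_less_iff[OF ne bdd] by blast
  qed
  then obtain y where y: "\<And>n. y n \<in> C n" "\<And>n. (L2norm \<mu> (y n))\<^sup>2 < d n + 1 / real (Suc n)"
    by metis
  have yL2: "y n \<in> L2 \<mu>" for n using y(1) L2 by blast
  \<comment> \<open>The midpoint lies in \<open>C N\<close>, so its squared norm is at least
    \<open>d N\<close>, while both endpoints have squared norm below
    \<open>L + 1 / real (Suc N)\<close>; the parallelogram identity does the rest.\<close>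
  have near: "(L2norm \<mu> (\<lambda>x. y m x - y n x))\<^sup>2 \<le> 4 * (L - d N) + 4 * (1 / real (Suc N))"
    if "m \<ge> N" "n \<ge> N" for m n N
  proof -
    have "y m \<in> C N" "y n \<in> C N" using y(1) decseqD[OF dec that(1)] decseqD[OF dec that(2)] by auto
    then have "d N \<le> (L2norm \<mu> (\<lambda>x. (1 / 2) *\<^sub>R y m x + (1 / 2) *\<^sub>R y n x))\<^sup>2"
      by (intro d_le mid)
    moreover have "1 / real (Suc m) \<le> 1 / real (Suc N)" "1 / real (Suc n) \<le> 1 / real (Suc N)"
      using that by (simp_all add: frac_le)
    ultimately show ?thesis
      using L2norm_lincomb_power2[OF yL2 yL2, of "1/2" m "1/2" n] L2norm_diff_power2[OF yL2 yL2, of m n]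
        y(2)[of m] y(2)[of n] L(2)[of m] L(2)[of n] by (simp add: power2_eq_square)
  qed
  have lim0: "(\<lambda>N. 4 * (L - d N) + 4 * (1 / real (Suc N))) \<longlonglongrightarrow> 4 * (L - L) + 4 * 0"
    by (intro tendsto_intros L LIMSEQ_Suc[OF lim_1_over_n])
  have "\<exists>N. \<forall>m\<ge>N. \<forall>n\<ge>N. L2norm \<mu> (\<lambda>x. y m x - y n x) < e" if "e > 0" for e
  proof -
    have "\<forall>\<^sub>F N in sequentially. 4 * (L - d N) + 4 * (1 / real (Suc N)) < e\<^sup>2"
      using lim0 that by (intro order_tendstoD) auto
    then obtain N where N: "4 * (L - d N) + 4 * (1 / real (Suc N)) < e\<^sup>2"
      by (auto simp: eventually_sequentially)
    have "L2norm \<mu> (\<lambda>x. y m x - y n x) < e" if "m \<ge> N" "n \<ge> N" for m n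
      using near[OF that] N \<open>e > 0\<close> by (intro power2_less_imp_less[of _ e]) auto
    then show ?thesis by blast
  qed
  from L2_complete[OF assms(1) yL2 this] y(1) that show thesis by blast
qed

lemma tendsto_integral_inner:
  assumes y: "\<And>n. y n \<in> L2 \<mu>" and "z \<in> L2 \<mu>" "\<xi> \<in> L2 \<mu>" "L2_tendsto \<mu> y z"
  shows "(\<lambda>n. \<integral>x. y n x \<bullet> \<xi> x \<partial>\<mu>) \<longlonglongrightarrow> (\<integral>x. z x \<bullet> \<xi> x \<partial>\<mu>)"
proof (rule LIM_zero_cancel, rule Lim_null_comparison)
  show "\<forall>\<^sub>F n in sequentially. norm ((\<integral>x. y n x \<bullet> \<xi> x \<partial>\<mu>) - (\<integral>x. z x \<bullet> \<xi> x \<partial>\<mu>))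
      \<le> L2norm \<mu> (\<lambda>x. y n x - z x) * L2norm \<mu> \<xi>"
    using L2_Cauchy_Schwarz[OF L2_diff[OF y assms(2)] assms(3)] assms
    by (auto intro!: always_eventually simp: inner_diff_left L2_inner_integrable)
  show "(\<lambda>n. L2norm \<mu> (\<lambda>x. y n x - z x) * L2norm \<mu> \<xi>) \<longlonglongrightarrow> 0"
    using assms(4) unfolding L2_tendsto_def by (rule tendsto_mult_left_zero)
qed

text \<open>One half of weak convergence; the other half is the same statement for
  \<open>- \<xi>\<close>. Failure infinitely often is enough to keep the sets of near minimizers in
  a half-space nonempty.\<close>

lemma minimizing_sequence_eventually_less:
  assumes \<mu>: "\<mu> \<in> P2" and lsc: "W2_lower_semicontinuous D"
    and conv: "convex_along_gen_geodesics 0 \<mu> D" and min: "is_unique_minimizer D \<gamma>"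
    and G: "G \<in> convex_gradients \<mu>" "distr \<mu> borel G = \<gamma>"
    and T: "\<And>k. T k \<in> convex_gradients \<mu>"
    and minimizing: "(\<lambda>k. D (distr \<mu> borel (T k))) \<longlonglongrightarrow> D \<gamma>"
    and bounded: "\<And>k. (L2norm \<mu> (T k))\<^sup>2 \<le> R"
    and \<xi>: "\<xi> \<in> L2 \<mu>" and "\<epsilon> > 0"
  shows "\<forall>\<^sub>F k in sequentially. (\<integral>x. T k x \<bullet> \<xi> x \<partial>\<mu>) < (\<integral>x. G x \<bullet> \<xi> x \<partial>\<mu>) + \<epsilon>"
proof (rule ccontr)
  assume "\<not> ?thesis"
  then have freq: "\<exists>\<^sub>F k in sequentially. (\<integral>x. G x \<bullet> \<xi> x \<partial>\<mu>) + \<epsilon> \<le> (\<integral>x. T k x \<bullet> \<xi> x \<partial>\<mu>)"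
    by (simp add: not_eventually not_less)
  define \<eta> where "\<eta> n = 1 / real (Suc n)" for n
  \<comment> \<open>Closed under midpoints by convexity of the functional and linearity of the
    half-space condition, and decreasing because \<open>\<eta>\<close> is.\<close>
  define C where "C n = {S \<in> convex_gradients \<mu>. D (distr \<mu> borel S) \<le> D \<gamma> + \<eta> n \<and>
      (\<integral>x. G x \<bullet> \<xi> x \<partial>\<mu>) + \<epsilon> \<le> (\<integral>x. S x \<bullet> \<xi> x \<partial>\<mu>)}" for n
  have mid: "(\<lambda>x. (1 / 2) *\<^sub>R f x + (1 / 2) *\<^sub>R g x) \<in> convex_gradients \<mu>"
    "D (distr \<mu> borel (\<lambda>x. (1 / 2) *\<^sub>R f x + (1 / 2) *\<^sub>R g x))
      \<le> (D (distr \<mu> borel f) + D (distr \<mu> borel g)) / 2"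
    if "f \<in> convex_gradients \<mu>" "g \<in> convex_gradients \<mu>" for f g
    using convex_gradients_convex[OF that, of "1/2"] gen_geodesic_convexD[OF conv \<mu> that, of "1/2"]
    by simp_all
  have \<gamma>_le: "D \<gamma> \<le> D \<nu>" if "\<nu> \<in> P2" for \<nu>
    using min that by (auto simp: is_unique_minimizer_def is_arg_min_linorder)
  have \<gamma>_unique: "\<nu> = \<gamma>" if "\<nu> \<in> P2" "D \<nu> \<le> D \<gamma>" for \<nu>
    using min that \<gamma>_le unfolding is_unique_minimizer_def is_arg_min_linorder
    by (meson order_trans)
  obtain y z where y: "\<And>n. y n \<in> C n" and z: "z \<in> L2 \<mu>" and lim: "L2_tendsto \<mu> y z"
  proof (rule convergent_selection_nested_convex[of \<mu> C R])
    show "prob_space \<mu>" using \<mu> by (rule P2_prob)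
    show "C n \<subseteq> L2 \<mu>" for n unfolding C_def using convex_gradients_L2 by blast
    have "\<eta> n \<le> \<eta> m" if "m \<le> n" for m n using that by (simp add: \<eta>_def frac_le)
    then show "decseq C" unfolding decseq_def C_def by fastforce
    show "(\<lambda>x. (1 / 2) *\<^sub>R f x + (1 / 2) *\<^sub>R g x) \<in> C n" if fg: "f \<in> C n" "g \<in> C n" for n f g
    proof -
      have K: "f \<in> convex_gradients \<mu>" "g \<in> convex_gradients \<mu>" using fg by (auto simp: C_def)
      have "(\<integral>x. ((1 / 2) *\<^sub>R f x + (1 / 2) *\<^sub>R g x) \<bullet> \<xi> x \<partial>\<mu>)
        = (1 / 2) * (\<integral>x. f x \<bullet> \<xi> x \<partial>\<mu>) + (1 / 2) * (\<integral>x. g x \<bullet> \<xi> x \<partial>\<mu>)"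
        using K[THEN convex_gradients_L2, THEN L2_inner_integrable, OF \<xi>] by (simp add: inner_add_left)
      with fg mid[OF K] show ?thesis by (simp add: C_def)
    qed
    show "\<exists>f\<in>C n. (L2norm \<mu> f)\<^sup>2 \<le> R" for n
    proof -
      \<comment> \<open>Near minimality holds eventually and the half-space condition frequently, so
        some \<open>T k\<close> satisfies both.\<close>
      have "\<forall>\<^sub>F k in sequentially. D (distr \<mu> borel (T k)) < D \<gamma> + \<eta> n"
        using minimizing by (rule order_tendstoD) (simp add: \<eta>_def)
      from frequently_eventually_frequently[OF freq this] obtain k where "T k \<in> C n"
        using T by (auto simp: C_def dest!: frequently_ex intro: less_imp_le)
      with bounded show ?thesis by blast
    qed
  qed blast
  have yK: "y n \<in> convex_gradients \<mu>" for n using y by (auto simp: C_def)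
  then have yL2: "y n \<in> L2 \<mu>" for n by (rule convex_gradients_L2)
  have GL2: "G \<in> L2 \<mu>" using G(1) by (rule convex_gradients_L2)
  have \<eta>: "\<eta> \<longlonglongrightarrow> 0" unfolding \<eta>_def by (rule LIMSEQ_Suc[OF lim_1_over_n])
  have Dy: "D (distr \<mu> borel (y n)) \<le> D \<gamma> + \<eta> n" for n using y[of n] by (simp add: C_def)
  have "D (distr \<mu> borel z) \<le> D \<gamma>"
    by (rule lsc_L2_limit[OF \<mu> lsc yL2 z lim Dy \<eta>])
  then have law_z: "distr \<mu> borel z = \<gamma>" by (intro \<gamma>_unique distr_P2 \<mu> z)
  \<comment> \<open>\<open>z\<close> is only known to lie in \<open>L2\<close>, so the midpoint
    estimate is made for \<open>y n\<close> and \<open>G\<close>, both convex gradients, and then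
    passed to the limit by lower semicontinuity.\<close>
  define u where "u n x = (1 / 2) *\<^sub>R y n x + (1 / 2) *\<^sub>R G x" for n x
  define w where "w x = (1 / 2) *\<^sub>R z x + (1 / 2) *\<^sub>R G x" for x
  have uL2: "u n \<in> L2 \<mu>" for n unfolding u_def using yL2 GL2 by (rule L2_lincomb)
  have wL2: "w \<in> L2 \<mu>" unfolding w_def using z GL2 by (rule L2_lincomb)
  have "L2norm \<mu> (\<lambda>x. u n x - w x) = L2norm \<mu> (\<lambda>x. y n x - z x) / 2" for n
  proof -
    have "u n x - w x = (1 / 2) *\<^sub>R (y n x - z x)" for x by (simp add: u_def w_def algebra_simps)
    then show ?thesis by (simp add: L2norm_def power_divide real_sqrt_divide)
  qed
  then have lim_u: "L2_tendsto \<mu> u w"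
    using tendsto_divide_zero[OF lim[unfolded L2_tendsto_def], of 2]
    unfolding L2_tendsto_def by (simp only:)
  have "D (distr \<mu> borel (u n)) \<le> D \<gamma> + \<eta> n" for n
  proof -
    have "\<eta> n \<ge> 0" by (simp add: \<eta>_def)
    then show ?thesis using mid(2)[OF yK[of n] G(1)] Dy[of n] unfolding u_def G(2) by simp
  qed
  from lsc_L2_limit[OF \<mu> lsc uL2 wL2 lim_u this \<eta>]
  have "distr \<mu> borel w = \<gamma>" by (intro \<gamma>_unique distr_P2 \<mu> wL2)
  then have "L2norm \<mu> (\<lambda>x. z x - G x) = 0"
    unfolding w_def by (rule eq_of_midpoint_law[OF z GL2 law_z G(2)])
  then have "(\<integral>x. z x \<bullet> \<xi> x \<partial>\<mu>) = (\<integral>x. G x \<bullet> \<xi> x \<partial>\<mu>)"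
    using L2_Cauchy_Schwarz[OF L2_diff[OF z GL2] \<xi>] L2_inner_integrable[OF z \<xi>]
      L2_inner_integrable[OF GL2 \<xi>] by (simp add: inner_diff_left)
  \<comment> \<open>The half-space condition survives the strong limit and separates
    \<open>z\<close> from \<open>G\<close>.\<close>
  moreover have "(\<integral>x. G x \<bullet> \<xi> x \<partial>\<mu>) + \<epsilon> \<le> (\<integral>x. z x \<bullet> \<xi> x \<partial>\<mu>)"
    using tendsto_integral_inner[OF yL2 z \<xi> lim] y
    by (intro tendsto_lowerbound) (auto simp: C_def)
  ultimately show False using \<open>\<epsilon> > 0\<close> by simp
qed

text \<open>The one-sided bounds for \<open>\<xi>\<close> and \<open>- \<xi>\<close> together
  control the absolute value.\<close>

lemma minimizing_sequence_weakly_tendsto: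
  assumes \<mu>: "\<mu> \<in> P2" and lsc: "W2_lower_semicontinuous D"
    and conv: "convex_along_gen_geodesics 0 \<mu> D" and min: "is_unique_minimizer D \<gamma>"
    and G: "G \<in> convex_gradients \<mu>" "distr \<mu> borel G = \<gamma>"
    and T: "\<And>k. T k \<in> convex_gradients \<mu>"
    and minimizing: "(\<lambda>k. D (distr \<mu> borel (T k))) \<longlonglongrightarrow> D \<gamma>"
    and bounded: "\<And>k. (L2norm \<mu> (T k))\<^sup>2 \<le> R"
  shows "L2_weakly_tendsto \<mu> T G"
  unfolding L2_weakly_tendsto_def
proof (intro ballI tendstoI)
  fix \<xi> :: "'a \<Rightarrow> 'a" and \<epsilon> :: real assume \<xi>: "\<xi> \<in> L2 \<mu>" and "\<epsilon> > 0"
  have neg: "(\<lambda>x. - \<xi> x) \<in> L2 \<mu>" using L2_lincomb[OF \<xi> \<xi>, of "-1" 0] by simp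
  note ev = minimizing_sequence_eventually_less[OF assms _ \<open>\<epsilon> > 0\<close>]
  from ev[OF \<xi>] ev[OF neg]
  show "\<forall>\<^sub>F k in sequentially. dist (\<integral>x. T k x \<bullet> \<xi> x \<partial>\<mu>) (\<integral>x. G x \<bullet> \<xi> x \<partial>\<mu>) < \<epsilon>"
    by eventually_elim (simp add: dist_real_def)
qed

section \<open>Convergence of the proximal scheme\<close>

theorem proposition3p1:
  fixes \<rho>\<^sub>0 \<gamma> :: "(real ^ 'n) measure"
    and D :: "(real ^ 'n) measure \<Rightarrow> real"
    and T :: "nat \<Rightarrow> real ^ 'n \<Rightarrow> real ^ 'n"
    and T\<^sub>\<gamma> :: "real ^ 'n \<Rightarrow> real ^ 'n"
    and lam \<tau> \<alpha> :: real
  assumes "\<rho>\<^sub>0 \<in> P2ac"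
    and "W2_lower_semicontinuous D"
    and "wasserstein_differentiable D"
    and "convex_along_gen_geodesics lam \<rho>\<^sub>0 D"
    and "is_unique_minimizer D \<gamma>"
    and "is_optimal_map \<rho>\<^sub>0 \<gamma> T\<^sub>\<gamma>"
    and "\<tau> > 0"
    and "proximal_scheme D \<rho>\<^sub>0 \<tau> T"
    and "\<alpha> = (1 + lam\<^sup>2 * \<tau>\<^sup>2 / 4) powr (- 1 / 2)"
  shows "(lam = 0 \<longrightarrow> L2_weakly_tendsto \<rho>\<^sub>0 T T\<^sub>\<gamma>) \<and>
         (lam > 0 \<longrightarrow> L2_tendsto \<rho>\<^sub>0 T T\<^sub>\<gamma> \<and> \<alpha> < 1 \<and>
            (\<lambda>k. L2norm \<rho>\<^sub>0 (\<lambda>x. T k x - T\<^sub>\<gamma> x)) \<in> O(\<lambda>k. \<alpha> ^ k))"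
proof -
  have \<rho>: "\<rho>\<^sub>0 \<in> P2" using assms(1) by (simp add: P2ac_def)
  have G: "T\<^sub>\<gamma> \<in> convex_gradients \<rho>\<^sub>0" "distr \<rho>\<^sub>0 borel T\<^sub>\<gamma> = \<gamma>"
    using assms(6) by (auto simp: is_optimal_map_def)
  have GL2: "T\<^sub>\<gamma> \<in> L2 \<rho>\<^sub>0" using G(1) by (rule convex_gradients_L2)
  have T0: "T 0 = id" and prox: "is_arg_min (\<lambda>S. D (distr \<rho>\<^sub>0 borel S)
        + 1 / (2 * \<tau>) * (L2norm \<rho>\<^sub>0 (\<lambda>x. S x - T k x))\<^sup>2)
      (\<lambda>S. S \<in> convex_gradients \<rho>\<^sub>0) (T (Suc k))" for k
    using assms(8) unfolding proximal_scheme_def by auto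
  have TK: "T (Suc k) \<in> convex_gradients \<rho>\<^sub>0" for k
    using prox[of k] by (simp add: is_arg_min_def)
  \<comment> \<open>The start \<open>T 0 = id\<close> enters only as an element of
    \<open>L2\<close>; membership in \<open>convex_gradients\<close> is recorded from
    \<open>T (Suc k)\<close> on, so the weak limit is first taken for the shifted sequence.\<close>
  have TL2: "T k \<in> L2 \<rho>\<^sub>0" for k
    using L2_ident[OF \<rho>] convex_gradients_L2[OF TK] by (cases k) (simp_all add: T0 id_def)
  define F where "F S = D (distr \<rho>\<^sub>0 borel S)" for S
  have F_min: "F T\<^sub>\<gamma> \<le> F S" if "S \<in> L2 \<rho>\<^sub>0" for S
    using assms(5) distr_P2[OF \<rho> that]
    by (auto simp: F_def G(2) is_unique_minimizer_def is_arg_min_linorder)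
  \<comment> \<open>The minimizer solves the proximal problem with \<open>c = 0\<close>, so the
    proximal inequality becomes quadratic growth.\<close>
  have growth: "F T\<^sub>\<gamma> + lam / 2 * (L2norm \<rho>\<^sub>0 (\<lambda>x. T\<^sub>\<gamma> x - S x))\<^sup>2 \<le> F S"
    if "S \<in> convex_gradients \<rho>\<^sub>0" for S
    using proximal_inequality[OF assms(4) \<rho> G(1) that GL2, of 0] F_min[OF convex_gradients_L2]
    unfolding F_def by simp
  define e where "e k = (L2norm \<rho>\<^sub>0 (\<lambda>x. T k x - T\<^sub>\<gamma> x))\<^sup>2" for k
  have swap: "L2norm \<rho>\<^sub>0 (\<lambda>x. f x - g x) = L2norm \<rho>\<^sub>0 (\<lambda>x. g x - f x)" for f g
    by (simp add: L2norm_def norm_minus_commute)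
  have step: "F (T (Suc k)) + 1 / (2 * \<tau>) * (L2norm \<rho>\<^sub>0 (\<lambda>x. T (Suc k) x - T k x))\<^sup>2
      + (lam + 1 / \<tau>) / 2 * e (Suc k) \<le> F T\<^sub>\<gamma> + 1 / (2 * \<tau>) * e k" for k
  proof -
    have half: "1 / \<tau> / 2 = 1 / (2 * \<tau>)" by simp
    from prox[of k] show ?thesis
      using proximal_inequality[OF assms(4) \<rho> TK[of k] G(1) TL2[of k], of "1 / \<tau>", unfolded half]
      by (simp add: F_def e_def is_arg_min_linorder swap[of T\<^sub>\<gamma>])
  qed
  show ?thesis
  proof (intro conjI impI)
    assume lam: "lam = 0"
    \<comment> \<open>The energy gap is controlled by a decrement of \<open>e\<close>. Hence
      \<open>e\<close> decreases to a limit, its decrements tend to 0, and the shifted scheme is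
      minimizing.\<close>
    have gap: "F (T (Suc k)) - F T\<^sub>\<gamma> \<le> (e k - e (Suc k)) / (2 * \<tau>)" for k
    proof -
      have "0 \<le> 1 / (2 * \<tau>) * (L2norm \<rho>\<^sub>0 (\<lambda>x. T (Suc k) x - T k x))\<^sup>2" using assms(7) by simp
      with step[of k] show ?thesis by (simp add: lam diff_divide_distrib)
    qed
    have "e (Suc k) \<le> e k" for k
    proof -
      have "0 \<le> (e k - e (Suc k)) / (2 * \<tau>)" using gap[of k] F_min[OF TL2[of "Suc k"]] by linarith
      then show ?thesis using assms(7) by (simp add: zero_le_divide_iff)
    qed
    then have dec: "decseq e" by (rule decseq_SucI)
    have "0 \<le> e k" for k by (simp add: e_def)
    with decseq_convergent[OF dec, of 0] obtain L where L: "e \<longlonglongrightarrow> L" by blast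
    have "(\<lambda>k. (e k - e (Suc k)) / (2 * \<tau>)) \<longlonglongrightarrow> (L - L) / (2 * \<tau>)"
      using assms(7) by (intro tendsto_intros L LIMSEQ_Suc[OF L]) auto
    then have "(\<lambda>k. (e k - e (Suc k)) / (2 * \<tau>)) \<longlonglongrightarrow> 0" by simp
    then have "(\<lambda>k. F (T (Suc k)) - F T\<^sub>\<gamma>) \<longlonglongrightarrow> 0"
      by (rule tendsto_sandwich[OF _ _ tendsto_const, rotated 2])
        (auto intro!: always_eventually gap F_min TL2)
    then have minimizing: "(\<lambda>k. D (distr \<rho>\<^sub>0 borel (T (Suc k)))) \<longlonglongrightarrow> D \<gamma>"
      unfolding F_def G(2) by (rule LIM_zero_cancel)
    \<comment> \<open>The difference of \<open>2 * e k + 2 * (L2norm \<rho>\<^sub>0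
      T\<^sub>\<gamma>)\<^sup>2\<close> and the squared norm of \<open>T k\<close> is the squared
      norm of \<open>T k - 2 T\<^sub>\<gamma>\<close>.\<close>
    have "(L2norm \<rho>\<^sub>0 (T k))\<^sup>2 \<le> 2 * e 0 + 2 * (L2norm \<rho>\<^sub>0 T\<^sub>\<gamma>)\<^sup>2" for k
    proof -
      have "0 \<le> (L2norm \<rho>\<^sub>0 (\<lambda>x. 1 *\<^sub>R T k x + (- 2) *\<^sub>R T\<^sub>\<gamma> x))\<^sup>2" by simp
      then have "(L2norm \<rho>\<^sub>0 (T k))\<^sup>2 \<le> 2 * e k + 2 * (L2norm \<rho>\<^sub>0 T\<^sub>\<gamma>)\<^sup>2"
        unfolding L2norm_lincomb_power2[OF TL2 GL2] e_def L2norm_diff_power2[OF TL2 GL2] by simp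
      with decseqD[OF dec, of 0 k] show ?thesis by simp
    qed
    then have "L2_weakly_tendsto \<rho>\<^sub>0 (\<lambda>k. T (Suc k)) T\<^sub>\<gamma>"
      using assms(4) unfolding lam
      by (intro minimizing_sequence_weakly_tendsto[OF \<rho> assms(2) _ assms(5) G TK minimizing])
    then show "L2_weakly_tendsto \<rho>\<^sub>0 T T\<^sub>\<gamma>"
      unfolding L2_weakly_tendsto_def by (auto intro: LIMSEQ_imp_Suc)
  next
    assume lam: "lam > 0"
    define s where "s = lam * \<tau>"
    have s: "s > 0" using lam assms(7) by (simp add: s_def)
    have \<alpha>: "\<alpha> = 1 / sqrt (1 + s\<^sup>2 / 4)"
      unfolding assms(9) s_def
      by (simp add: powr_minus powr_half_sqrt power_mult_distrib divide_simps flip: minus_divide_left)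
    have root_gt: "1 < sqrt (1 + s\<^sup>2 / 4)" using s by simp
    then have \<alpha>_pos: "\<alpha> > 0" unfolding \<alpha> by (intro divide_pos_pos) linarith+
    show \<alpha>_less: "\<alpha> < 1" unfolding \<alpha> using root_gt by (subst divide_less_eq_1_pos) linarith+
    \<comment> \<open>Since \<open>(1 + s)\<^sup>2\<close> exceeds \<open>1 + s\<^sup>2 / 4\<close>,
      the factor \<open>1 / (1 + s)\<close> of the contraction is at least as good as
      \<open>\<alpha>\<close>.\<close>
    have rate: "1 / (1 + s) \<le> \<alpha>"
    proof -
      have "sqrt (1 + s\<^sup>2 / 4) \<le> 1 + s"
        using s by (intro real_le_lsqrt) (auto simp: power2_eq_square algebra_simps)
      then show ?thesis unfolding \<alpha> using root_gt by (intro frac_le) linarith+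
    qed
    define a where "a k = L2norm \<rho>\<^sub>0 (\<lambda>x. T k x - T\<^sub>\<gamma> x)" for k
    have contraction: "a (Suc k) \<le> \<alpha> * a k" for k
    proof -
      define b where "b = (L2norm \<rho>\<^sub>0 (\<lambda>x. T (Suc k) x - T k x))\<^sup>2"
      have "F T\<^sub>\<gamma> + lam / 2 * e (Suc k) \<le> F (T (Suc k))"
        using growth[OF TK[of k]] swap[of T\<^sub>\<gamma>] by (simp add: e_def)
      \<comment> \<open>Adding quadratic growth to the step doubles the share of \<open>lam\<close>;
        this is the origin of the coefficient \<open>1 + 2 * s\<close> required by
        \<open>proximal_contraction\<close>.\<close>
      with step[of k] have "lam / 2 * e (Suc k) + 1 / (2 * \<tau>) * b + (lam + 1 / \<tau>) / 2 * e (Suc k)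
          \<le> 1 / (2 * \<tau>) * e k" unfolding b_def by linarith
      moreover have "lam / 2 * e (Suc k) + 1 / (2 * \<tau>) * b + (lam + 1 / \<tau>) / 2 * e (Suc k)
          = ((1 + 2 * s) * e (Suc k) + b) / (2 * \<tau>)"
        using assms(7) by (simp add: s_def field_simps)
      ultimately have "(1 + 2 * s) * e (Suc k) + b \<le> e k"
        using assms(7) by (simp add: divide_le_cancel)
      then have "(1 + s) * a (Suc k) \<le> a k"
        unfolding e_def a_def b_def by (intro proximal_contraction[OF TL2 TL2 GL2 s])
      then have "a (Suc k) \<le> 1 / (1 + s) * a k" using s by (simp add: field_simps)
      also have "\<dots> \<le> \<alpha> * a k" using rate by (rule mult_right_mono) (simp add: a_def L2norm_nonneg)
      finally show ?thesis .
    qed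
    have a_le: "a k \<le> a 0 * \<alpha> ^ k" for k
    proof (induction k)
      case (Suc k)
      have "\<alpha> * a k \<le> \<alpha> * (a 0 * \<alpha> ^ k)" using Suc \<alpha>_pos by (intro mult_left_mono) auto
      with contraction[of k] show ?case by (simp add: mult_ac)
    qed simp
    show "(\<lambda>k. L2norm \<rho>\<^sub>0 (\<lambda>x. T k x - T\<^sub>\<gamma> x)) \<in> O(\<lambda>k. \<alpha> ^ k)"
      using a_le \<alpha>_pos unfolding a_def
      by (intro bigoI[of _ "a 0"] always_eventually) (auto simp: L2norm_nonneg a_def)
    have "(\<lambda>k. a 0 * \<alpha> ^ k) \<longlonglongrightarrow> 0"
      using \<alpha>_pos \<alpha>_less by (intro tendsto_mult_right_zero LIMSEQ_power_zero) auto
    then have "a \<longlonglongrightarrow> 0"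
      by (rule tendsto_sandwich[OF _ _ tendsto_const, rotated 2]) (use a_le in \<open>auto simp: a_def L2norm_nonneg\<close>)
    then show "L2_tendsto \<rho>\<^sub>0 T T\<^sub>\<gamma>" by (simp add: L2_tendsto_def a_def[abs_def])
  qed
qed

end
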